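(* Let $P=(p_{ij})$ be a $3\times n$ complex matrix whose columns represent $n$ distinct points $p_1,\dots,p_n\in\mathbb{P}^2_{\mathbb{C}}$, not all on a line, and let $\mathbf{v}=(v_1,\dots,v_n)$ be a vector of positive integers. Let $K=\ker(P)\subset\mathbb{C}^n$, let $H_{\mathbf{v}}=\{(c_1,\dots,c_n)\in(\mathbb{C}^* )^n \mid c_1^{v_1}\cdots c_n^{v_n}=1\}$, and let $G$ be the group of all automorphisms $\sigma_{\mathbf{c},\mathbf{b}}$ ($\mathbf{c}\in H_{\mathbf{v}}$, $\mathbf{b}\in K$) of the polynomial ring $\mathbb{C}[\mathbf{x},\mathbf{y}]=\mathbb{C}[x_1,\dots,x_n,y_1,\dots,y_n]$ given by $$\sigma_{\mathbf{c},\mathbf{b}}(x_i)=c_ix_i,\qquad \sigma_{\mathbf{c},\mathbf{b}}(y_i)=\frac{c_i}{c_1\cdots c_n}(y_i+b_ix_i),\qquad 1\le i\le n.$$ Let $Z_{\mathbf{v}}=v_1p_1+\cdots+v_np_n\subset\mathbb{P}^2$. Then $$\mathbb{C}[\mathbf{x},\mathbf{y}]^G\;\cong\;\bigoplus_{m\in\mathbb{Z}}I(mZ_{\mathbf{v}})\;=\;\bigoplus_{m\in\mathbb{Z},\,d\ge 0}[I(mZ_{\mathbf{v}})]_d$$ (isomorphism of $\mathbb{C}$-algebras).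
   Context: $\mathbb{C}[\mathbb{P}^2]$ is the homogeneous coordinate ring of $\mathbb{P}^2_{\mathbb{C}}$ and $I(p_j)\subset\mathbb{C}[\mathbb{P}^2]$ is the homogeneous ideal of the point $p_j$. For $m\in\mathbb{Z}$, $I(mZ_{\mathbf{v}})=\bigcap_{j=1}^nI(p_j)^{mv_j}$, where $I(p_j)^k=\mathbb{C}[\mathbb{P}^2]$ for $k\le 0$. For a homogeneous ideal $I$, $I_d$ (or $[I]_d$) is its homogeneous component of degree $d$. The direct sum $\bigoplus_m I(mZ_{\mathbf{v}})$ is a $\mathbb{C}$-algebra (Rees algebra of the filtration) with multiplication induced by $I(mZ_{\mathbf{v}})\,I(m'Z_{\mathbf{v}})\subseteq I((m+m')Z_{\mathbf{v}})$. $A^G$ denotes the ring of $G$-invariant elements of $A$. *)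

theory Defs
  imports "HOL-Analysis.Analysis" "HOL-Library.Poly_Mapping"
begin

section \<open>Commutative complex algebras\<close>

text \<open>The structure map \<open>scalar\<close> is the ring homomorphism from the complex numbers that
  makes the ring a complex algebra.\<close>

class complex_calg = comm_ring_1 +
  fixes scalar :: "complex \<Rightarrow> 'a"
  assumes scalar_one: "scalar 1 = 1"
    and scalar_add: "scalar (a + b) = scalar a + scalar b"
    and scalar_mult: "scalar (a * b) = scalar a * scalar b"

instantiation complex :: complex_calg
begin
definition scalar_complex :: "complex \<Rightarrow> complex"
  where "scalar_complex a = a"
instance
  by standard (simp_all add: scalar_complex_def)
end

instantiation poly_mapping :: (comm_monoid_add, complex_calg) complex_calg
begin
definition scalar_poly_mapping :: "complex \<Rightarrow> 'a \<Rightarrow>\<^sub>0 'b"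
  where "scalar_poly_mapping a = Poly_Mapping.single 0 (scalar a)"
instance
  by standard (simp_all add: scalar_poly_mapping_def scalar_one scalar_add scalar_mult
      single_add mult_single)
end

definition subalgebra :: "'a::complex_calg set \<Rightarrow> bool"
  where "subalgebra A \<longleftrightarrow>
    range scalar \<subseteq> A \<and> (\<forall>f\<in>A. \<forall>g\<in>A. f + g \<in> A \<and> f * g \<in> A)"

text \<open>Unitality and compatibility with scalar multiplication both follow from
  compatibility with \<open>scalar\<close>.\<close>

definition algebra_iso :: "'a::complex_calg set \<Rightarrow> 'b::complex_calg set \<Rightarrow> ('a \<Rightarrow> 'b) \<Rightarrow> bool"
  where "algebra_iso A B \<phi> \<longleftrightarrow>
    subalgebra A \<and> subalgebra B \<and> bij_betw \<phi> A B \<and>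
    (\<forall>f\<in>A. \<forall>g\<in>A. \<phi> (f + g) = \<phi> f + \<phi> g \<and> \<phi> (f * g) = \<phi> f * \<phi> g) \<and>
    (\<forall>a. \<phi> (scalar a) = scalar a)"

section \<open>Polynomials\<close>

text \<open>Monomials are finitely supported exponent functions; the multiplication of
  \<^theory>\<open>HOL-Library.Poly_Mapping\<close> is the convolution product, that is, the product of polynomials.\<close>

type_synonym 'v cpoly = "('v \<Rightarrow>\<^sub>0 nat) \<Rightarrow>\<^sub>0 complex"

definition Var :: "'v \<Rightarrow> 'v cpoly"
  where "Var i = Poly_Mapping.single (Poly_Mapping.single i 1) 1"

text \<open>The algebra homomorphism sending the variable \<open>i\<close> to \<open>\<theta> i\<close>. With values in
  \<^typ>\<open>complex\<close> it is evaluation at a point.\<close>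

definition subst :: "('v \<Rightarrow> 'a::complex_calg) \<Rightarrow> 'v cpoly \<Rightarrow> 'a"
  where "subst \<theta> f =
    (\<Sum>\<mu>\<in>Poly_Mapping.keys f. scalar (Poly_Mapping.lookup f \<mu>) *
      (\<Prod>i\<in>Poly_Mapping.keys \<mu>. \<theta> i ^ Poly_Mapping.lookup \<mu> i))"

lemma subst_Var [simp]: "subst \<theta> (Var i) = \<theta> i"
  by (simp add: subst_def Var_def scalar_one)

text \<open>The zero polynomial is homogeneous of every degree.\<close>

definition homogeneous :: "nat \<Rightarrow> 'v cpoly \<Rightarrow> bool"
  where "homogeneous d f \<longleftrightarrow>
    (\<forall>\<mu>\<in>Poly_Mapping.keys f. (\<Sum>i\<in>Poly_Mapping.keys \<mu>. Poly_Mapping.lookup \<mu> i) = d)"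

definition hom_component :: "'v cpoly set \<Rightarrow> nat \<Rightarrow> 'v cpoly set"
  where "hom_component I d = {f \<in> I. homogeneous d f}"

section \<open>Ideals\<close>

definition ideal_gen :: "'a::comm_ring_1 set \<Rightarrow> 'a set"
  where "ideal_gen S = module.span (*) S"

primrec ideal_power :: "'a::comm_ring_1 set \<Rightarrow> nat \<Rightarrow> 'a set"
  where
    "ideal_power I 0 = UNIV"
  | "ideal_power I (Suc k) = ideal_gen {f * g | f g. f \<in> I \<and> g \<in> ideal_power I k}"

section \<open>Points of the projective plane and fat point ideals\<close>

definition proj_point :: "complex ^ 3 \<Rightarrow> (complex ^ 3) set"
  where "proj_point p = {c *s p | c. c \<noteq> 0}"

definition proj_line :: "complex ^ 3 \<Rightarrow> (complex ^ 3) set set"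
  where "proj_line a = {proj_point p | p. p \<noteq> 0 \<and> (\<Sum>k\<in>UNIV. a $ k * p $ k) = 0}"

text \<open>For a homogeneous polynomial, vanishing at \<open>p\<close> does not depend on the representative
  chosen for the projective point.\<close>

definition point_ideal :: "complex ^ 3 \<Rightarrow> 3 cpoly set"
  where "point_ideal p = ideal_gen {f. (\<exists>d. homogeneous d f) \<and> subst (\<lambda>k. p $ k) f = 0}"

text \<open>\<^const>\<open>nat\<close> truncates negative exponents to 0, and the zeroth power is the whole ring.\<close>

definition fat_ideal :: "complex ^ 'n ^ 3 \<Rightarrow> ('n::finite \<Rightarrow> nat) \<Rightarrow> int \<Rightarrow> 3 cpoly set"
  where "fat_ideal P v m =
    (\<Inter>j\<in>UNIV. ideal_power (point_ideal (column j P)) (nat (m * int (v j))))"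

text \<open>The direct sums are realised as finitely supported families, indexed by \<open>m\<close> and by
  \<open>(m, d)\<close> respectively. The convolution product on the ambient types is the multiplication
  induced by the products of the summands.\<close>

definition rees_algebra :: "complex ^ 'n ^ 3 \<Rightarrow> ('n::finite \<Rightarrow> nat) \<Rightarrow> (int \<Rightarrow>\<^sub>0 3 cpoly) set"
  where "rees_algebra P v = {F. \<forall>m. Poly_Mapping.lookup F m \<in> fat_ideal P v m}"

definition bigraded_rees_algebra ::
    "complex ^ 'n ^ 3 \<Rightarrow> ('n::finite \<Rightarrow> nat) \<Rightarrow> (int \<times> nat \<Rightarrow>\<^sub>0 3 cpoly) set"
  where "bigraded_rees_algebra P v =
    {F. \<forall>m d. Poly_Mapping.lookup F (m, d) \<in> hom_component (fat_ideal P v m) d}"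

definition sum_degrees :: "(int \<times> nat \<Rightarrow>\<^sub>0 3 cpoly) \<Rightarrow> (int \<Rightarrow>\<^sub>0 3 cpoly)"
  where "sum_degrees F =
    (\<Sum>(m, d)\<in>Poly_Mapping.keys F. Poly_Mapping.single m (Poly_Mapping.lookup F (m, d)))"

section \<open>The group action\<close>

text \<open>The variables \<open>x\<^sub>i\<close> and \<open>y\<^sub>i\<close> are indexed by \<^term>\<open>Inl i\<close> and \<^term>\<open>Inr i\<close>.\<close>

definition sigma :: "complex ^ 'n \<Rightarrow> complex ^ 'n \<Rightarrow> ('n::finite + 'n) cpoly \<Rightarrow> ('n + 'n) cpoly"
  where "sigma c b = subst (case_sum
    (\<lambda>i. scalar (c $ i) * Var (Inl i))
    (\<lambda>i. scalar (c $ i / (\<Prod>j\<in>UNIV. c $ j)) * (Var (Inr i) + scalar (b $ i) * Var (Inl i))))"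

definition kernel :: "complex ^ 'n ^ 3 \<Rightarrow> (complex ^ 'n::finite) set"
  where "kernel P = {b. P *v b = 0}"

definition torus :: "('n::finite \<Rightarrow> nat) \<Rightarrow> (complex ^ 'n) set"
  where "torus v = {c. (\<forall>i. c $ i \<noteq> 0) \<and> (\<Prod>i\<in>UNIV. (c $ i) ^ v i) = 1}"

definition sigma_group ::
    "complex ^ 'n ^ 3 \<Rightarrow> ('n::finite \<Rightarrow> nat) \<Rightarrow> (('n + 'n) cpoly \<Rightarrow> ('n + 'n) cpoly) set"
  where "sigma_group P v = {sigma c b | c b. c \<in> torus v \<and> b \<in> kernel P}"

definition invariants :: "('a \<Rightarrow> 'a) set \<Rightarrow> 'a set"
  where "invariants G = {f. \<forall>\<sigma>\<in>G. \<sigma> f = f}"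

end

theory Submission
  imports Defs
begin

text \<open>Where no \<open>x\<^sub>i\<close> vanishes, the quotients \<open>y\<^sub>i / x\<^sub>i\<close> are translated by the kernel of \<open>P\<close>, so the
  kernel leaves invariant exactly the functions of \<open>x\<close> and of
  \<open>z\<^sub>k = x\<^sub>1 \<cdots> x\<^sub>n (\<Sum>\<^sub>i p\<^sub>k\<^sub>i y\<^sub>i / x\<^sub>i)\<close>, for \<open>k = 1, 2, 3\<close>. The torus fixes \<open>z\<close>, and the Laurent monomials in
  \<open>x\<close> that it fixes are the powers of \<open>\<tau> = x\<^sup>v\<close>. Hence an invariant polynomial is
  a sum of terms \<open>F\<^sub>m(z) / \<tau>\<^sup>m\<close>, and such a term is a polynomial iff
  \<open>x\<^sub>j\<^bsup>m v\<^sub>j\<^esup>\<close> divides \<open>F\<^sub>m(z)\<close> for all \<open>j\<close>. As \<open>z\<close> is a multiple of \<open>p\<^sub>j\<close> modulo \<open>x\<^sub>j\<close> and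
  otherwise generic, this means that \<open>F\<^sub>m\<close> vanishes to order \<open>m v\<^sub>j\<close> at \<open>p\<^sub>j\<close>. Laurent
  polynomials are avoided by comparing both sides at complex points with nonzero \<open>x\<^sub>i\<close>, which is the
  relation \<open>corresponds\<close>.\<close>

abbreviation lookup :: "('a \<Rightarrow>\<^sub>0 'b::zero) \<Rightarrow> 'a \<Rightarrow> 'b"
  where "lookup \<equiv> Poly_Mapping.lookup"
abbreviation keys :: "('a \<Rightarrow>\<^sub>0 'b::zero) \<Rightarrow> 'a set"
  where "keys \<equiv> Poly_Mapping.keys"
abbreviation single :: "'a \<Rightarrow> 'b \<Rightarrow> 'a \<Rightarrow>\<^sub>0 'b::zero"
  where "single \<equiv> Poly_Mapping.single"

section \<open>Homomorphisms from convolution algebras\<close>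

lemma sum_single_lookup:
  assumes "finite S" "keys f \<subseteq> S"
  shows "(\<Sum>a\<in>S. single a (lookup f a)) = (f :: 'a \<Rightarrow>\<^sub>0 'b::comm_monoid_add)"
proof (rule poly_mapping_eqI)
  fix k
  have "lookup (\<Sum>a\<in>S. single a (lookup f a)) k = (\<Sum>a\<in>S. if a = k then lookup f a else 0)"
    by (simp add: lookup_sum lookup_single when_def)
  also have "\<dots> = lookup f k"
    using assms by (auto simp: not_in_keys_iff_lookup_eq_zero)
  finally show "lookup (\<Sum>a\<in>S. single a (lookup f a)) k = lookup f k" .
qed

lemmas sum_single_keys = sum_single_lookup[OF finite_keys subset_refl]

lemma poly_mapping_mult_expand:
  fixes f g :: "'a::monoid_add \<Rightarrow>\<^sub>0 'b::semiring_0"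
  shows "f * g = (\<Sum>a\<in>keys f. \<Sum>b\<in>keys g. single (a + b) (lookup f a * lookup g b))"
proof -
  have "f * g = (\<Sum>a\<in>keys f. single a (lookup f a)) * (\<Sum>b\<in>keys g. single b (lookup g b))"
    by (simp only: sum_single_keys)
  then show ?thesis
    by (simp add: sum_product mult_single)
qed

section \<open>Selecting terms by their exponent\<close>

definition restrict_keys :: "('a \<Rightarrow> bool) \<Rightarrow> ('a \<Rightarrow>\<^sub>0 'b) \<Rightarrow> ('a \<Rightarrow>\<^sub>0 'b::comm_monoid_add)"
  where "restrict_keys Q f = (\<Sum>a\<in>{a \<in> keys f. Q a}. single a (lookup f a))"

lemma lookup_restrict_keys: "lookup (restrict_keys Q f) a = (if Q a then lookup f a else 0)"
proof -
  have "lookup (restrict_keys Q f) a = (\<Sum>b\<in>{b \<in> keys f. Q b}. if b = a then lookup f b else 0)"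
    by (simp add: restrict_keys_def lookup_sum lookup_single when_def)
  also have "\<dots> = (if Q a then lookup f a else 0)"
    by (auto simp: not_in_keys_iff_lookup_eq_zero)
  finally show ?thesis .
qed

lemma keys_restrict_keys: "keys (restrict_keys Q f) = {a \<in> keys f. Q a}"
  by (auto simp: in_keys_iff lookup_restrict_keys split: if_splits)

lemma restrict_keys_sum: "restrict_keys Q (\<Sum>i\<in>A. f i) = (\<Sum>i\<in>A. restrict_keys Q (f i))"
  by (rule poly_mapping_eqI) (simp add: lookup_restrict_keys lookup_sum)

lemma restrict_keys_eq_self: "(\<And>a. a \<in> keys f \<Longrightarrow> Q a) \<Longrightarrow> restrict_keys Q f = f"
  by (rule poly_mapping_eqI) (auto simp: lookup_restrict_keys in_keys_iff)

lemma restrict_keys_eq_0: "(\<And>a. a \<in> keys f \<Longrightarrow> \<not> Q a) \<Longrightarrow> restrict_keys Q f = 0"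
  by (rule poly_mapping_eqI) (auto simp: lookup_restrict_keys in_keys_iff)

text \<open>Each exponent lies in exactly one fibre of \<open>e\<close>. Used for the decomposition
  by degree and, later, by torus weight.\<close>

lemma sum_restrict_keys:
  assumes "finite S" "e ` keys f \<subseteq> S"
  shows "(\<Sum>d\<in>S. restrict_keys (\<lambda>a. e a = d) f) = f"
proof (rule poly_mapping_eqI)
  fix k
  have "lookup (\<Sum>d\<in>S. restrict_keys (\<lambda>a. e a = d) f) k = (\<Sum>d\<in>S. if e k = d then lookup f k else 0)"
    by (simp add: lookup_sum lookup_restrict_keys)
  also have "\<dots> = lookup f k"
    using assms by (cases "k \<in> keys f") (auto simp: in_keys_iff)
  finally show "lookup (\<Sum>d\<in>S. restrict_keys (\<lambda>a. e a = d) f) k = lookup f k" .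
qed

section \<open>Homomorphisms given by the images of coefficients and exponents\<close>

definition induced :: "('b \<Rightarrow> 'c) \<Rightarrow> ('a \<Rightarrow> 'c) \<Rightarrow> ('a \<Rightarrow>\<^sub>0 'b::zero) \<Rightarrow> 'c::comm_ring_1"
  where "induced h \<kappa> F = (\<Sum>a\<in>keys F. h (lookup F a) * \<kappa> a)"

text \<open>Three maps are multiplicative for this one reason: \<open>subst\<close>, the evaluation
  of Rees elements in \<open>corresponds\<close>, and \<open>sum_degrees\<close>.\<close>

locale induced_hom =
  fixes h :: "'b::comm_ring_1 \<Rightarrow> 'c::comm_ring_1" and \<kappa> :: "'a::comm_monoid_add \<Rightarrow> 'c"
  assumes h_add: "h (r + s) = h r + h s"
    and h_mult: "h (r * s) = h r * h s"
    and \<kappa>_add: "\<kappa> (a + b) = \<kappa> a * \<kappa> b"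
begin

lemma h_0: "h 0 = 0"
  using h_add[of 0 0] by simp

lemma superset:
  assumes "finite S" "keys F \<subseteq> S"
  shows "induced h \<kappa> F = (\<Sum>a\<in>S. h (lookup F a) * \<kappa> a)"
  unfolding induced_def using assms
  by (intro sum.mono_neutral_left) (auto simp: in_keys_iff h_0)

lemma single: "induced h \<kappa> (single a r) = h r * \<kappa> a"
  using superset[of "{a}" "single a r"] by simp

lemma zero: "induced h \<kappa> 0 = 0"
  by (simp add: induced_def)

lemma add: "induced h \<kappa> (F + G) = induced h \<kappa> F + induced h \<kappa> G"
proof -
  have "keys (F + G) \<subseteq> keys F \<union> keys G"
    by (rule keys_add)
  then show ?thesis
    by (simp add: superset[of "keys F \<union> keys G"] lookup_add h_add distrib_right sum.distrib)
qed

lemma sum: "induced h \<kappa> (\<Sum>i\<in>A. F i) = (\<Sum>i\<in>A. induced h \<kappa> (F i))"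
  by (induction A rule: infinite_finite_induct) (simp_all add: zero add)

lemma mult: "induced h \<kappa> (F * G) = induced h \<kappa> F * induced h \<kappa> G"
proof -
  have "induced h \<kappa> (F * G) =
      (\<Sum>a\<in>keys F. \<Sum>b\<in>keys G. h (lookup F a * lookup G b) * \<kappa> (a + b))"
    by (subst poly_mapping_mult_expand) (simp only: sum single)
  then show ?thesis
    by (simp add: h_mult \<kappa>_add induced_def sum_product mult_ac)
qed

lemma minus: "induced h \<kappa> (F - G) = induced h \<kappa> F - induced h \<kappa> G"
  using add[of "F - G" G] by (simp add: algebra_simps)

end

lemma scalar_0: "scalar 0 = 0"
  using scalar_add[of 0 0] by simp

lemma scalar_diff: "scalar (a - b) = scalar a - scalar b"
  by (simp add: eq_diff_eq flip: scalar_add)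

lemma scalar_sum: "scalar (\<Sum>i\<in>A. f i) = (\<Sum>i\<in>A. scalar (f i))"
  by (induction A rule: infinite_finite_induct) (simp_all add: scalar_0 scalar_add)

section \<open>Substitution into polynomials\<close>

definition monomial :: "('v \<Rightarrow> 'a::comm_ring_1) \<Rightarrow> ('v \<Rightarrow>\<^sub>0 nat) \<Rightarrow> 'a"
  where "monomial \<theta> \<mu> = (\<Prod>i\<in>keys \<mu>. \<theta> i ^ lookup \<mu> i)"

lemma monomial_superset: "finite S \<Longrightarrow> keys \<mu> \<subseteq> S \<Longrightarrow> monomial \<theta> \<mu> = (\<Prod>i\<in>S. \<theta> i ^ lookup \<mu> i)"
  unfolding monomial_def by (intro prod.mono_neutral_left) (auto simp: in_keys_iff)

lemma monomial_UNIV: "monomial \<theta> \<mu> = (\<Prod>i\<in>UNIV. \<theta> i ^ lookup \<mu> i)" for \<theta> :: "'v::finite \<Rightarrow> _"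
  by (rule monomial_superset) auto

lemma monomial_0 [simp]: "monomial \<theta> 0 = 1"
  by (simp add: monomial_def)

lemma monomial_add: "monomial \<theta> (\<mu> + \<nu>) = monomial \<theta> \<mu> * monomial \<theta> \<nu>"
proof -
  have "keys (\<mu> + \<nu>) \<subseteq> keys \<mu> \<union> keys \<nu>"
    by (rule keys_add)
  then show ?thesis
    by (simp add: monomial_superset[of "keys \<mu> \<union> keys \<nu>"] lookup_add power_add prod.distrib)
qed

lemma subst_eq_induced: "subst \<theta> = induced scalar (monomial \<theta>)"
  by (simp add: fun_eq_iff subst_def induced_def monomial_def)

interpretation subst: induced_hom scalar "monomial \<theta>" for \<theta>
  by standard (simp_all add: scalar_add scalar_mult monomial_add)

lemmas subst_single = subst.single[folded subst_eq_induced]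
lemmas subst_0 [simp] = subst.zero[folded subst_eq_induced]
lemmas subst_add = subst.add[folded subst_eq_induced]
lemmas subst_sum = subst.sum[folded subst_eq_induced]
lemmas subst_mult = subst.mult[folded subst_eq_induced]
lemmas subst_minus = subst.minus[folded subst_eq_induced]

lemma subst_alt: "subst \<theta> f = (\<Sum>\<mu>\<in>keys f. scalar (lookup f \<mu>) * monomial \<theta> \<mu>)"
  by (simp add: subst_def monomial_def)

lemma subst_scalar [simp]: "subst \<theta> (scalar c) = scalar c"
  by (simp add: scalar_poly_mapping_def[where 'b = complex] subst_single scalar_complex_def)

lemma subst_1 [simp]: "subst \<theta> 1 = 1"
  using subst_scalar[of \<theta> 1] by (simp add: scalar_one)

lemma subst_power: "subst \<theta> (f ^ n) = subst \<theta> f ^ n"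
  by (induction n) (simp_all add: subst_mult)

lemma subst_prod: "subst \<theta> (\<Prod>i\<in>A. f i) = (\<Prod>i\<in>A. subst \<theta> (f i))"
  by (induction A rule: infinite_finite_induct) (simp_all add: subst_mult)

lemma subst_monomial: "subst \<eta> (monomial \<theta> \<mu>) = monomial (\<lambda>i. subst \<eta> (\<theta> i)) \<mu>"
  by (simp add: monomial_def subst_prod subst_power)

lemma subst_subst: "subst \<eta> (subst \<theta> f) = subst (\<lambda>i. subst \<eta> (\<theta> i)) f"
  by (simp add: subst_alt[of \<theta>] subst_alt[of "\<lambda>i. subst \<eta> (\<theta> i)"] subst_sum subst_mult subst_monomial)

lemma single_eq_scalar_mult: "single \<mu> c = scalar c * (single \<mu> 1 :: 'v cpoly)"
  by (simp add: scalar_poly_mapping_def mult_single scalar_complex_def)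

lemma Var_power: "Var i ^ n = single (single i n) 1"
proof (induction n)
  case (Suc n)
  then show ?case
    by (simp add: Var_def mult_single flip: single_add)
qed simp

lemma prod_single_1: "(\<Prod>i\<in>A. single (\<mu> i) 1) = (single (\<Sum>i\<in>A. \<mu> i) 1 :: 'a::comm_monoid_add \<Rightarrow>\<^sub>0 'b::comm_ring_1)"
  by (induction A rule: infinite_finite_induct) (simp_all add: mult_single)

lemma monomial_Var: "monomial Var \<mu> = single \<mu> 1"
  by (simp add: monomial_def Var_power prod_single_1 sum_single_keys)

lemma subst_Var_self: "subst Var f = f"
  by (simp add: subst_alt monomial_Var sum_single_keys flip: single_eq_scalar_mult)

section \<open>Weighted degrees\<close>

text \<open>Constant weights 1 give the total degree, the weights \<open>off k\<close> the degree in
  the variables other than \<open>k\<close>, an indicator the exponent of one variable.\<close>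

definition wdeg :: "('v \<Rightarrow> nat) \<Rightarrow> ('v \<Rightarrow>\<^sub>0 nat) \<Rightarrow> nat"
  where "wdeg w \<mu> = (\<Sum>i\<in>keys \<mu>. w i * lookup \<mu> i)"

lemma wdeg_superset: "finite S \<Longrightarrow> keys \<mu> \<subseteq> S \<Longrightarrow> wdeg w \<mu> = (\<Sum>i\<in>S. w i * lookup \<mu> i)"
  unfolding wdeg_def by (intro sum.mono_neutral_left) (auto simp: in_keys_iff)

lemma wdeg_UNIV: "wdeg w \<mu> = (\<Sum>i\<in>UNIV. w i * lookup \<mu> i)" for w :: "'v::finite \<Rightarrow> nat"
  by (rule wdeg_superset) auto

lemma wdeg_add: "wdeg w (\<mu> + \<nu>) = wdeg w \<mu> + wdeg w \<nu>"
proof -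
  have "keys (\<mu> + \<nu>) \<subseteq> keys \<mu> \<union> keys \<nu>"
    by (rule keys_add)
  then show ?thesis
    by (simp add: wdeg_superset[of "keys \<mu> \<union> keys \<nu>"] lookup_add distrib_left sum.distrib)
qed

lemma wdeg_single [simp]: "wdeg w (single i n) = w i * n"
  by (simp add: wdeg_superset[of "{i}"])

lemma wdeg_indicator: "wdeg (\<lambda>j. if j = i then 1 else 0) \<mu> = lookup \<mu> i"
proof -
  have "wdeg (\<lambda>j. if j = i then 1 else 0) \<mu> = (\<Sum>j\<in>insert i (keys \<mu>). if j = i then lookup \<mu> j else 0)"
    by (subst wdeg_superset[of "insert i (keys \<mu>)"], simp, blast, intro sum.cong) simp_all
  then show ?thesis
    by simp
qed

text \<open>A monomial ideal. For the weights \<open>off k\<close> it is a power of the ideal of a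
  coordinate point; for weight 1 on \<open>Inl j\<close> alone it expresses divisibility by a power
  of \<open>x\<^sub>j\<close>.\<close>

definition order_ge :: "('v \<Rightarrow> nat) \<Rightarrow> nat \<Rightarrow> 'v cpoly set"
  where "order_ge w K = {f. \<forall>\<mu>\<in>keys f. K \<le> wdeg w \<mu>}"

lemma order_ge_0 [simp]: "order_ge w 0 = UNIV"
  by (simp add: order_ge_def)

lemma order_ge_zero [simp]: "0 \<in> order_ge w K"
  by (simp add: order_ge_def)

lemma order_ge_add: "f \<in> order_ge w K \<Longrightarrow> g \<in> order_ge w K \<Longrightarrow> f + g \<in> order_ge w K"
  using keys_add[of f g] unfolding order_ge_def by blast

lemma order_ge_sum: "(\<And>i. i \<in> A \<Longrightarrow> f i \<in> order_ge w K) \<Longrightarrow> (\<Sum>i\<in>A. f i) \<in> order_ge w K"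
  by (induction A rule: infinite_finite_induct) (simp_all add: order_ge_add)

lemma order_ge_mult:
  assumes "f \<in> order_ge w K" "g \<in> order_ge w L"
  shows "f * g \<in> order_ge w (K + L)"
proof -
  { fix \<mu> assume "\<mu> \<in> keys (f * g)"
    then obtain a b where "\<mu> = a + b" "a \<in> keys f" "b \<in> keys g"
      using keys_mult[of f g] by blast
    then have "K + L \<le> wdeg w \<mu>"
      using assms by (auto simp: order_ge_def wdeg_add intro: add_mono) }
  then show ?thesis by (simp add: order_ge_def)
qed

lemma order_ge_mult_left: "g \<in> order_ge w K \<Longrightarrow> f * g \<in> order_ge w K"
  using order_ge_mult[of f w 0 g K] by simp

lemma order_ge_mono: "f \<in> order_ge w K \<Longrightarrow> L \<le> K \<Longrightarrow> f \<in> order_ge w L"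
  by (auto simp: order_ge_def)

lemma order_ge_power: "f \<in> order_ge w K \<Longrightarrow> f ^ n \<in> order_ge w (K * n)"
  by (induction n) (auto dest: order_ge_mult)

lemma order_ge_prod:
  "(\<And>i. i \<in> A \<Longrightarrow> f i \<in> order_ge w (k i)) \<Longrightarrow> (\<Prod>i\<in>A. f i) \<in> order_ge w (\<Sum>i\<in>A. k i)"
  by (induction A rule: infinite_finite_induct) (simp_all add: order_ge_mult)

text \<open>Orders add up in products, so the image of the monomial \<open>\<mu>\<close> has order
  at least \<open>wdeg w \<mu>\<close>.\<close>

lemma order_ge_subst:
  assumes "f \<in> order_ge w K" "\<And>i. \<theta> i \<in> order_ge w' (w i)"
  shows "subst \<theta> f \<in> order_ge w' K"
  unfolding subst_alt
proof (rule order_ge_sum, rule order_ge_mult_left)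
  fix \<mu> assume "\<mu> \<in> keys f"
  have "monomial \<theta> \<mu> \<in> order_ge w' (wdeg w \<mu>)"
    unfolding monomial_def wdeg_def by (intro order_ge_prod order_ge_power assms)
  then show "monomial \<theta> \<mu> \<in> order_ge w' K"
    by (rule order_ge_mono) (use assms(1) \<open>\<mu> \<in> keys f\<close> in \<open>auto simp: order_ge_def\<close>)
qed

section \<open>Homogeneous polynomials and homogeneous parts\<close>

lemma homogeneous_iff: "homogeneous d f \<longleftrightarrow> (\<forall>\<mu>\<in>keys f. wdeg (\<lambda>_. 1) \<mu> = d)"
  by (simp add: homogeneous_def wdeg_def)

lemma homogeneous_0 [simp]: "homogeneous d 0"
  by (simp add: homogeneous_def)

lemma homogeneous_add: "homogeneous d f \<Longrightarrow> homogeneous d g \<Longrightarrow> homogeneous d (f + g)"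
  using keys_add[of f g] unfolding homogeneous_def by blast

lemma homogeneous_sum: "(\<And>i. i \<in> A \<Longrightarrow> homogeneous d (f i)) \<Longrightarrow> homogeneous d (\<Sum>i\<in>A. f i)"
  by (induction A rule: infinite_finite_induct) (simp_all add: homogeneous_add)

lemma homogeneous_mult:
  assumes "homogeneous d f" "homogeneous e g"
  shows "homogeneous (d + e) (f * g)"
proof -
  { fix \<mu> assume "\<mu> \<in> keys (f * g)"
    then obtain a b where "\<mu> = a + b" "a \<in> keys f" "b \<in> keys g"
      using keys_mult[of f g] by blast
    then have "wdeg (\<lambda>_. 1) \<mu> = d + e"
      using assms by (simp add: homogeneous_iff wdeg_add) }
  then show ?thesis by (simp add: homogeneous_iff)
qed

lemma homogeneous_scalar [simp]: "homogeneous 0 (scalar c :: 'v cpoly)"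
  by (simp add: homogeneous_def scalar_poly_mapping_def)

lemma homogeneous_1 [simp]: "homogeneous 0 1"
  by (simp add: homogeneous_def)

lemma homogeneous_Var [simp]: "homogeneous (Suc 0) (Var i)"
  by (simp add: homogeneous_iff Var_def)

lemma homogeneous_scalar_mult: "homogeneous d f \<Longrightarrow> homogeneous d (scalar c * f)"
  using homogeneous_mult[of 0 "scalar c" d f] by simp

lemma homogeneous_power: "homogeneous d f \<Longrightarrow> homogeneous (d * n) (f ^ n)"
  by (induction n) (auto dest: homogeneous_mult)

lemma homogeneous_prod:
  "(\<And>i. i \<in> A \<Longrightarrow> homogeneous (k i) (f i)) \<Longrightarrow> homogeneous (\<Sum>i\<in>A. k i) (\<Prod>i\<in>A. f i)"
  by (induction A rule: infinite_finite_induct) (simp_all add: homogeneous_mult)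

lemma homogeneous_subst:
  assumes "homogeneous d f" "\<And>i. homogeneous 1 (\<theta> i)"
  shows "homogeneous d (subst \<theta> f :: 'w cpoly)"
  unfolding subst_alt
proof (rule homogeneous_sum, rule homogeneous_scalar_mult)
  fix \<mu> assume "\<mu> \<in> keys f"
  have "homogeneous (wdeg (\<lambda>_. 1) \<mu>) (monomial \<theta> \<mu>)"
    unfolding monomial_def wdeg_def by (intro homogeneous_prod homogeneous_power assms)
  then show "homogeneous d (monomial \<theta> \<mu>)"
    using assms(1) \<open>\<mu> \<in> keys f\<close> by (auto simp: homogeneous_iff)
qed

definition hom_part :: "nat \<Rightarrow> 'v cpoly \<Rightarrow> 'v cpoly"
  where "hom_part d = restrict_keys (\<lambda>\<mu>. wdeg (\<lambda>_. 1) \<mu> = d)"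

lemma homogeneous_hom_part [simp]: "homogeneous d (hom_part d f)"
  by (simp add: homogeneous_iff hom_part_def keys_restrict_keys)

lemma hom_part_homogeneous: "homogeneous d f \<Longrightarrow> hom_part e f = (if d = e then f else 0)"
  by (auto simp: homogeneous_iff hom_part_def intro: restrict_keys_eq_0 restrict_keys_eq_self)

lemma hom_part_sum: "hom_part d (\<Sum>i\<in>A. f i) = (\<Sum>i\<in>A. hom_part d (f i))"
  by (simp add: hom_part_def restrict_keys_sum)

lemma sum_hom_part:
  "finite S \<Longrightarrow> wdeg (\<lambda>_. 1) ` keys f \<subseteq> S \<Longrightarrow> (\<Sum>d\<in>S. hom_part d f) = f"
  unfolding hom_part_def by (rule sum_restrict_keys)

text \<open>Substituting linear forms preserves degrees, so the decomposition of \<open>f\<close> is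
  carried to that of its image.\<close>

lemma hom_part_subst:
  assumes "\<And>i. homogeneous 1 (\<theta> i)"
  shows "hom_part d (subst \<theta> f) = (subst \<theta> (hom_part d f) :: 'w cpoly)"
proof -
  \<comment> \<open>\<open>d\<close> is inserted so that the sum has a term for \<open>d\<close>
    even if \<open>f\<close> has no monomial of that degree.\<close>
  let ?S = "insert d (wdeg (\<lambda>_. 1) ` keys f)"
  have "hom_part d (subst \<theta> f) = hom_part d (subst \<theta> (\<Sum>e\<in>?S. hom_part e f))"
    by (subst sum_hom_part) auto
  also have "\<dots> = (\<Sum>e\<in>?S. hom_part d (subst \<theta> (hom_part e f)))"
    by (simp only: subst_sum hom_part_sum)
  also have "\<dots> = (\<Sum>e\<in>?S. if e = d then subst \<theta> (hom_part e f) else 0)"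
    by (intro sum.cong refl hom_part_homogeneous homogeneous_subst assms) simp
  also have "\<dots> = subst \<theta> (hom_part d f)"
    by (subst sum.delta) auto
  finally show ?thesis .
qed

lemma order_ge_hom_part: "f \<in> order_ge w K \<Longrightarrow> hom_part d f \<in> order_ge w K"
  by (simp add: order_ge_def hom_part_def keys_restrict_keys)

section \<open>Independence of characters\<close>

text \<open>Artin-Dedekind independence of characters, stated on a set closed under an operation so
  that it serves for points with nonzero coordinates as well as for nonzero numbers. The induction
  eliminates \<open>\<kappa> s\<close> and then uses points where the other characters differ from
  it.\<close>

lemma characters_independent:
  fixes \<kappa> :: "'i \<Rightarrow> 'x \<Rightarrow> 'k::field" and mul :: "'x \<Rightarrow> 'x \<Rightarrow> 'x"
  assumes "finite S" "X \<noteq> {}"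
    and closed: "\<And>x y. x \<in> X \<Longrightarrow> y \<in> X \<Longrightarrow> mul x y \<in> X"
    and hom: "\<And>i x y. i \<in> S \<Longrightarrow> x \<in> X \<Longrightarrow> y \<in> X \<Longrightarrow> \<kappa> i (mul x y) = \<kappa> i x * \<kappa> i y"
    and nonzero: "\<And>i x. i \<in> S \<Longrightarrow> x \<in> X \<Longrightarrow> \<kappa> i x \<noteq> 0"
    and distinct: "\<And>i j. i \<in> S \<Longrightarrow> j \<in> S \<Longrightarrow> i \<noteq> j \<Longrightarrow> \<exists>x\<in>X. \<kappa> i x \<noteq> \<kappa> j x"
    and "\<And>x. x \<in> X \<Longrightarrow> (\<Sum>i\<in>S. a i * \<kappa> i x) = 0"
  shows "\<forall>i\<in>S. a i = 0"
  using assms(1) hom nonzero distinct assms(7)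
proof (induction S arbitrary: a)
  case (insert s S)
  have S: "a i * (\<kappa> i y - \<kappa> s y) = 0" if "y \<in> X" "i \<in> S" for y i
  proof -
    have "\<forall>i\<in>S. a i * (\<kappa> i y - \<kappa> s y) = 0"
    proof (rule insert.IH)
      fix x assume x: "x \<in> X"
      \<comment> \<open>Subtracting \<open>\<kappa> s y\<close> times the relation at
        \<open>x\<close> from the relation at \<open>mul x y\<close> cancels the term of
        \<open>s\<close>.\<close>
      have "0 = (\<Sum>i\<in>insert s S. a i * \<kappa> i (mul x y)) - (\<Sum>i\<in>insert s S. a i * \<kappa> i x) * \<kappa> s y"
        by (simp only: insert.prems(4)[OF x] insert.prems(4)[OF closed[OF x \<open>y \<in> X\<close>]] mult_zero_left diff_zero)
      also have "\<dots> = (\<Sum>i\<in>S. a i * \<kappa> i (mul x y)) - (\<Sum>i\<in>S. a i * \<kappa> i x) * \<kappa> s y"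
        using insert.hyps insert.prems(1)[of s x y] x that by (simp add: algebra_simps)
      also have "\<dots> = (\<Sum>i\<in>S. a i * \<kappa> i (mul x y) - a i * \<kappa> i x * \<kappa> s y)"
        by (simp add: sum_subtractf sum_distrib_right)
      also have "\<dots> = (\<Sum>i\<in>S. a i * (\<kappa> i y - \<kappa> s y) * \<kappa> i x)"
        using insert.prems(1) x that by (intro sum.cong) (simp_all add: algebra_simps)
      finally show "(\<Sum>i\<in>S. a i * (\<kappa> i y - \<kappa> s y) * \<kappa> i x) = 0" by simp
    qed (use insert.prems in auto)
    with that show ?thesis by blast
  qed
  have a0: "a i = 0" if i: "i \<in> S" for i
  proof -
    have "i \<noteq> s"
      using insert.hyps i by blast
    then obtain y where "y \<in> X" "\<kappa> i y \<noteq> \<kappa> s y"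
      using insert.prems(3)[of i s] i by blast
    with S[of y i] i show ?thesis by simp
  qed
  obtain x where x: "x \<in> X" using \<open>X \<noteq> {}\<close> by blast
  have "a s = 0"
    using insert.prems(4)[OF x] insert.prems(2)[OF _ x, of s] insert.hyps a0 by simp
  with a0 show ?case by simp
qed simp

lemma monomial_mult: "monomial (\<lambda>i. x i * y i) \<mu> = monomial x \<mu> * monomial y \<mu>"
  by (simp add: monomial_def power_mult_distrib prod.distrib)

lemma monomials_independent:
  fixes a :: "('v \<Rightarrow>\<^sub>0 nat) \<Rightarrow> complex"
  assumes "finite S" "\<And>x. (\<And>i. x i \<noteq> 0) \<Longrightarrow> (\<Sum>\<mu>\<in>S. a \<mu> * monomial x \<mu>) = 0"
  shows "\<forall>\<mu>\<in>S. a \<mu> = 0"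
proof (rule characters_independent[where X = "{x. \<forall>i. x i \<noteq> 0}" and mul = "\<lambda>x y i. x i * y i"
      and \<kappa> = "\<lambda>\<mu> x. monomial x \<mu>"])
  fix \<mu> \<nu> :: "'v \<Rightarrow>\<^sub>0 nat" assume "\<mu> \<noteq> \<nu>"
  then obtain i where i: "lookup \<mu> i \<noteq> lookup \<nu> i"
    by (meson poly_mapping_eqI)
  \<comment> \<open>The point separating the two characters has 2 in a coordinate where the
    exponents differ and 1 elsewhere.\<close>
  have "monomial (\<lambda>j. if j = i then 2 else 1) \<rho> = (2::complex) ^ lookup \<rho> i" for \<rho>
  proof -
    have "monomial (\<lambda>j. if j = i then 2 else 1) \<rho> =
        (\<Prod>j\<in>insert i (keys \<rho>). if j = i then (2::complex) ^ lookup \<rho> i else 1)"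
      by (subst monomial_superset[of "insert i (keys \<rho>)"], simp, blast, intro prod.cong) simp_all
    then show ?thesis by simp
  qed
  moreover have "(2::complex) ^ lookup \<mu> i \<noteq> 2 ^ lookup \<nu> i"
  proof
    assume "(2::complex) ^ lookup \<mu> i = 2 ^ lookup \<nu> i"
    then have "of_nat (2 ^ lookup \<mu> i) = (of_nat (2 ^ lookup \<nu> i) :: complex)"
      by simp
    then have "(2::nat) ^ lookup \<mu> i = 2 ^ lookup \<nu> i"
      by (simp only: of_nat_eq_iff)
    with i show False by simp
  qed
  ultimately show "\<exists>x\<in>{x. \<forall>i. x i \<noteq> (0::complex)}. monomial x \<mu> \<noteq> monomial x \<nu>"
    by (intro bexI[of _ "\<lambda>j. if j = i then 2 else 1"]) auto
qed (use assms in \<open>auto simp: monomial_mult monomial_def intro!: exI[of _ "\<lambda>_. 1"]\<close>)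

lemma subst_complex_alt: "subst x f = (\<Sum>\<mu>\<in>keys f. lookup f \<mu> * monomial x \<mu>)"
  for x :: "'v \<Rightarrow> complex"
  by (simp add: subst_alt scalar_complex_def)

text \<open>The coefficients of \<open>f - g\<close> form a vanishing combination of distinct
  monomials. Testing only at nonzero coordinates is what permits division by the
  \<open>x\<^sub>i\<close> later.\<close>

lemma poly_eq_on_torus:
  fixes f g :: "'v cpoly"
  assumes "\<And>x :: 'v \<Rightarrow> complex. (\<And>i. x i \<noteq> 0) \<Longrightarrow> subst x f = subst x g"
  shows "f = g"
proof -
  have "\<forall>\<mu>\<in>keys (f - g). lookup (f - g) \<mu> = 0"
    using assms
    by (intro monomials_independent) (simp_all add: subst_minus flip: subst_complex_alt)
  then have "keys (f - g) = {}"
    using in_keys_iff by blast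
  then show ?thesis
    by (simp only: keys_eq_empty right_minus_eq)
qed

lemma laurent_independent:
  fixes a :: "int \<Rightarrow> complex"
  assumes "finite S" "\<And>t. t \<noteq> 0 \<Longrightarrow> (\<Sum>m\<in>S. a m * t powi (- m)) = 0"
  shows "\<forall>m\<in>S. a m = 0"
proof (rule characters_independent[where X = "{t. t \<noteq> 0}" and mul = "(*)"
      and \<kappa> = "\<lambda>m t. t powi (- m)"])
  fix m n :: int assume "m \<noteq> n"
  have "(2::complex) powi (- m) \<noteq> 2 powi (- n)"
  proof
    assume "(2::complex) powi (- m) = 2 powi (- n)"
    \<comment> \<open>Norms reduce the claim to real powers of 2, which determine the
      exponent.\<close>
    then have "cmod (2 powi (- m)) = cmod (2 powi (- n))" by simp
    then have "(2::real) powi (- m) = 2 powi (- n)"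
      by (simp add: norm_power_int)
    then have "(2::real) powr (- m) = 2 powr (- n)"
      by (simp flip: powr_real_of_int')
    with \<open>m \<noteq> n\<close> show False by (simp add: powr_inj)
  qed
  then show "\<exists>t\<in>{t. t \<noteq> 0}. t powi (- m) \<noteq> (t::complex) powi (- n)"
    by (intro bexI[of _ 2]) auto
qed (use assms in \<open>auto simp: power_int_mult_distrib intro!: exI[of _ 1]\<close>)

section \<open>Powers of the ideal of a point\<close>

lemma module_mult: "module ((*) :: 'a::comm_ring_1 \<Rightarrow> 'a \<Rightarrow> 'a)"
  by standard (simp_all add: algebra_simps)

lemma ideal_gen_base: "f \<in> S \<Longrightarrow> f \<in> ideal_gen S"
  unfolding ideal_gen_def by (rule module.span_base[OF module_mult])

lemma ideal_gen_zero: "0 \<in> ideal_gen S"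
  unfolding ideal_gen_def by (rule module.span_zero[OF module_mult])

lemma ideal_gen_add: "f \<in> ideal_gen S \<Longrightarrow> g \<in> ideal_gen S \<Longrightarrow> f + g \<in> ideal_gen S"
  unfolding ideal_gen_def by (rule module.span_add[OF module_mult])

lemma ideal_gen_mult: "f \<in> ideal_gen S \<Longrightarrow> c * f \<in> ideal_gen S"
  unfolding ideal_gen_def by (rule module.span_scale[OF module_mult])

lemma ideal_gen_minimal:
  assumes "S \<subseteq> J" "0 \<in> J" "\<And>f g. f \<in> J \<Longrightarrow> g \<in> J \<Longrightarrow> f + g \<in> J" "\<And>c f. f \<in> J \<Longrightarrow> c * f \<in> J"
  shows "ideal_gen S \<subseteq> J"
  unfolding ideal_gen_def using assms
  by (intro module.span_minimal[OF module_mult]) (auto simp: module.subspace_def[OF module_mult])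

lemma ideal_power_zero: "0 \<in> ideal_power I k"
  by (cases k) (simp_all add: ideal_gen_zero)

lemma ideal_power_add: "f \<in> ideal_power I k \<Longrightarrow> g \<in> ideal_power I k \<Longrightarrow> f + g \<in> ideal_power I k"
  by (cases k) (simp_all add: ideal_gen_add)

lemma ideal_power_sum: "(\<And>i. i \<in> A \<Longrightarrow> f i \<in> ideal_power I k) \<Longrightarrow> (\<Sum>i\<in>A. f i) \<in> ideal_power I k"
  by (induction A rule: infinite_finite_induct) (simp_all add: ideal_power_zero ideal_power_add)

lemma ideal_power_mult_left: "f \<in> ideal_power I k \<Longrightarrow> c * f \<in> ideal_power I k"
  by (cases k) (simp_all add: ideal_gen_mult)

lemma ideal_power_Suc_mult: "f \<in> I \<Longrightarrow> g \<in> ideal_power I k \<Longrightarrow> f * g \<in> ideal_power I (Suc k)"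
  by (auto intro: ideal_gen_base)

lemma ideal_power_Suc_subset: "ideal_power I (Suc k) \<subseteq> ideal_power I k"
proof -
  have "ideal_gen {f * g | f g. f \<in> I \<and> g \<in> ideal_power I k} \<subseteq> ideal_power I k"
    by (rule ideal_gen_minimal)
      (auto simp: ideal_power_zero intro: ideal_power_add ideal_power_mult_left)
  then show ?thesis by simp
qed

lemma ideal_power_antimono: "j \<le> k \<Longrightarrow> ideal_power I k \<subseteq> ideal_power I j"
  using lift_Suc_antimono_le[of "ideal_power I" j k] ideal_power_Suc_subset by blast

lemma power_mult_ideal_power: "f \<in> I \<Longrightarrow> g \<in> ideal_power I k \<Longrightarrow> f ^ r * g \<in> ideal_power I (r + k)"
proof (induction r)
  case (Suc r)
  then show ?case
    using ideal_power_Suc_mult[of f I "f ^ r * g" "r + k"] by (simp add: mult.assoc)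
qed simp

lemma prod_ideal_power:
  assumes "finite A" "\<And>i. i \<in> A \<Longrightarrow> f i \<in> I"
  shows "(\<Prod>i\<in>A. f i ^ r i) \<in> ideal_power I (\<Sum>i\<in>A. r i)"
  using assms by (induction A) (auto intro: power_mult_ideal_power)

text \<open>If \<open>p $ k \<noteq> 0\<close>, the linear forms \<open>x\<^sub>i - (p\<^sub>i / p\<^sub>k) x\<^sub>k\<close>, for \<open>i \<noteq> k\<close>, cut out the point \<open>p\<close>.
  The coordinate change \<open>to_coord p k\<close> turns them into variables, so that the order of vanishing
  becomes the weighted degree with weights \<open>off k\<close>.\<close>

definition to_coord :: "complex ^ 'v \<Rightarrow> 'v \<Rightarrow> 'v \<Rightarrow> 'v cpoly"
  where "to_coord p k i = (if i = k then 0 else Var i) + scalar (p $ i / p $ k) * Var k"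

definition from_coord :: "complex ^ 'v \<Rightarrow> 'v \<Rightarrow> 'v \<Rightarrow> 'v cpoly"
  where "from_coord p k i = (if i = k then Var k else Var i - scalar (p $ i / p $ k) * Var k)"

definition off :: "'v \<Rightarrow> 'v \<Rightarrow> nat"
  where "off k i = (if i = k then 0 else 1)"

lemma homogeneous_to_coord: "homogeneous 1 (to_coord p k i)"
  unfolding to_coord_def by (auto intro!: homogeneous_add homogeneous_scalar_mult)

lemma subst_from_to_coord:
  assumes "p $ k \<noteq> 0"
  shows "subst (from_coord p k) (subst (to_coord p k) f) = f"
proof -
  have "subst (from_coord p k) (to_coord p k i) = Var i" for i
    using assms by (simp add: to_coord_def from_coord_def subst_add subst_mult scalar_one)
  then have "subst (from_coord p k) (subst (to_coord p k) f) = subst Var f"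
    unfolding subst_subst by presburger
  then show ?thesis by (simp add: subst_Var_self)
qed

lemma from_coord_in_point_ideal:
  assumes "p $ k \<noteq> 0" "i \<noteq> k"
  shows "from_coord p k i \<in> point_ideal p"
proof -
  have "scalar (- (p $ i / p $ k)) + scalar (p $ i / p $ k) = (0 :: 3 cpoly)"
    by (simp add: scalar_0 flip: scalar_add)
  then have "scalar (- (p $ i / p $ k)) = - (scalar (p $ i / p $ k) :: 3 cpoly)"
    by (simp add: add_eq_0_iff2)
  then have "from_coord p k i = Var i + scalar (- (p $ i / p $ k)) * Var k"
    using assms by (simp add: from_coord_def)
  then have "homogeneous 1 (from_coord p k i)"
    by (simp add: homogeneous_add homogeneous_scalar_mult)
  moreover have "subst (\<lambda>k. p $ k) (from_coord p k i) = 0"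
    using assms by (simp add: from_coord_def subst_minus subst_mult scalar_complex_def)
  ultimately show ?thesis
    unfolding point_ideal_def by (intro ideal_gen_base) blast
qed

text \<open>In the new coordinates \<open>p\<close> becomes a multiple of the \<open>k\<close>-th
  unit vector. A homogeneous polynomial vanishing there has no pure power of the variable
  \<open>k\<close>, so each of its monomials contains another variable.\<close>

lemma subst_to_coord_order_1:
  fixes h :: "'v::finite cpoly"
  assumes k: "p $ k \<noteq> 0" and "homogeneous d h" "subst (\<lambda>k. p $ k) h = 0"
  shows "subst (to_coord p k) h \<in> order_ge (off k) 1"
proof -
  let ?g = "subst (to_coord p k) h" and ?a = "\<lambda>i. if i = k then p $ k else 0"
  have hom: "homogeneous d ?g"
    by (intro homogeneous_subst homogeneous_to_coord assms)
  have "subst ?a (to_coord p k i) = p $ i" for i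
    using k by (simp add: to_coord_def subst_add subst_mult scalar_complex_def)
  then have "subst ?a ?g = 0"
    unfolding subst_subst using assms by simp
  have "wdeg (off k) \<mu> \<noteq> 0" if \<mu>: "\<mu> \<in> keys ?g" for \<mu>
  proof
    \<comment> \<open>Weight 0 leaves only the variable \<open>k\<close>, and homogeneity fixes its
      exponent.\<close>
    have single: "\<nu> = single k d" if "\<nu> \<in> keys ?g" "wdeg (off k) \<nu> = 0" for \<nu>
    proof (rule poly_mapping_eqI)
      have off: "lookup \<nu> i = 0" if "i \<noteq> k" for i
        using \<open>wdeg (off k) \<nu> = 0\<close> that by (auto simp: wdeg_UNIV off_def split: if_splits)
      have "d = (\<Sum>i\<in>UNIV. lookup \<nu> i)"
        using hom \<open>\<nu> \<in> keys ?g\<close> by (simp add: homogeneous_iff wdeg_UNIV)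
      also have "\<dots> = (\<Sum>i\<in>{k}. lookup \<nu> i)"
        using off by (intro sum.mono_neutral_right) auto
      finally show "lookup \<nu> i = lookup (single k d) i" for i
        using off by (cases "i = k") (auto simp: lookup_single_not_eq)
    qed
    assume 0: "wdeg (off k) \<mu> = 0"
    \<comment> \<open>Every other monomial vanishes at \<open>?a\<close>, so the value there is the
      coefficient of the pure power times \<open>p $ k ^ d\<close>.\<close>
    have vanish: "monomial ?a \<nu> = 0" if "\<nu> \<in> keys ?g - {\<mu>}" for \<nu>
    proof -
      have "wdeg (off k) \<nu> \<noteq> 0"
        using single[of \<nu>] single[OF \<mu> 0] that by auto
      then obtain i where "i \<noteq> k" "lookup \<nu> i \<noteq> 0"
        by (auto simp: wdeg_UNIV off_def split: if_splits)
      then show ?thesis by (auto simp: monomial_UNIV intro!: prod_zero bexI[of _ i])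
    qed
    have "0 = (\<Sum>\<nu>\<in>keys ?g. lookup ?g \<nu> * monomial ?a \<nu>)"
      using \<open>subst ?a ?g = 0\<close> by (simp add: subst_complex_alt)
    also have "\<dots> = (\<Sum>\<nu>\<in>{\<mu>}. lookup ?g \<nu> * monomial ?a \<nu>)"
      using \<mu> vanish by (intro sum.mono_neutral_right) auto
    finally have "lookup ?g \<mu> * monomial ?a \<mu> = 0"
      by simp
    moreover have "monomial ?a \<mu> = p $ k ^ d"
      unfolding single[OF \<mu> 0] by (simp add: monomial_superset[of "{k}"])
    ultimately show False
      using \<mu> k by (simp add: in_keys_iff)
  qed
  then show ?thesis
    by (auto simp: order_ge_def Suc_le_eq)
qed

text \<open>Forward, the polynomials of order at least \<open>K\<close> form an ideal, and orders
  add up in products. Backward, a monomial of order at least \<open>K\<close> is pulled back to a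
  multiple of a product of at least \<open>K\<close> linear forms from the point ideal.\<close>

lemma ideal_power_point_ideal:
  assumes k: "p $ k \<noteq> 0"
  shows "f \<in> ideal_power (point_ideal p) K \<longleftrightarrow> subst (to_coord p k) f \<in> order_ge (off k) K"
proof
  define J where "J K = {f. subst (to_coord p k) f \<in> order_ge (off k) K}" for K
  have J: "ideal_gen S \<subseteq> J K" if "S \<subseteq> J K" for S K
    by (rule ideal_gen_minimal[OF that])
      (auto simp: J_def subst_add subst_mult intro: order_ge_add order_ge_mult_left)
  have "point_ideal p \<subseteq> J 1"
    unfolding point_ideal_def
    by (rule J) (auto simp: J_def intro!: subst_to_coord_order_1[OF k] simp del: One_nat_def)
  then have "ideal_power (point_ideal p) K \<subseteq> J K"
  proof (induction K)
    case (Suc K)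
    have "{f * g | f g. f \<in> point_ideal p \<and> g \<in> ideal_power (point_ideal p) K} \<subseteq> J (Suc K)"
      using Suc by (auto simp: J_def subst_mult dest!: subsetD intro: order_ge_mult[of _ _ 1 _ K, simplified])
    then show ?case using J by simp
  qed (simp add: J_def)
  then show "f \<in> ideal_power (point_ideal p) K \<Longrightarrow> subst (to_coord p k) f \<in> order_ge (off k) K"
    by (auto simp: J_def)
next
  let ?g = "subst (to_coord p k) f"
  assume g: "?g \<in> order_ge (off k) K"
  have "subst (from_coord p k) ?g \<in> ideal_power (point_ideal p) K"
    unfolding subst_alt[of _ ?g]
  proof (rule ideal_power_sum, rule ideal_power_mult_left)
    fix \<mu> assume \<mu>: "\<mu> \<in> keys ?g"
    have "(\<Sum>i\<in>-{k}. lookup \<mu> i) = wdeg (off k) \<mu>"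
      unfolding wdeg_UNIV by (rule sum.mono_neutral_cong_left) (auto simp: off_def)
    with g \<mu> have "K \<le> (\<Sum>i\<in>-{k}. lookup \<mu> i)"
      by (auto simp: order_ge_def)
    moreover have "(\<Prod>i\<in>-{k}. from_coord p k i ^ lookup \<mu> i) \<in>
        ideal_power (point_ideal p) (\<Sum>i\<in>-{k}. lookup \<mu> i)"
      by (intro prod_ideal_power) (auto intro: from_coord_in_point_ideal[OF k])
    ultimately have "(\<Prod>i\<in>-{k}. from_coord p k i ^ lookup \<mu> i) \<in> ideal_power (point_ideal p) K"
      using ideal_power_antimono by blast
    moreover have "monomial (from_coord p k) \<mu> =
        from_coord p k k ^ lookup \<mu> k * (\<Prod>i\<in>-{k}. from_coord p k i ^ lookup \<mu> i)"
      unfolding monomial_UNIV Compl_eq_Diff_UNIV by (rule prod.remove) auto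
    ultimately show "monomial (from_coord p k) \<mu> \<in> ideal_power (point_ideal p) K"
      by (simp add: ideal_power_mult_left)
  qed
  then show "f \<in> ideal_power (point_ideal p) K"
    by (simp add: subst_from_to_coord[OF k])
qed

section \<open>The correspondence between polynomials and elements of the Rees algebra\<close>

text \<open>The polynomial \<open>z\<^sub>k\<close>; the quotients by \<open>x\<^sub>i\<close> are absorbed into the product.\<close>

definition zform :: "complex ^ 'n ^ 3 \<Rightarrow> 3 \<Rightarrow> ('n::finite + 'n) cpoly"
  where "zform P k = (\<Sum>i\<in>UNIV. scalar (P $ k $ i) * (Var (Inr i) * (\<Prod>l\<in>-{i}. Var (Inl l))))"

definition zval :: "complex ^ 'n ^ 3 \<Rightarrow> ('n::finite \<Rightarrow> complex) \<Rightarrow> ('n \<Rightarrow> complex) \<Rightarrow> 3 \<Rightarrow> complex"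
  where "zval P x y k = subst (case_sum x y) (zform P k)"

text \<open>This is the graph of the isomorphism; the exponent \<open>- m\<close> encodes the
  division of the component \<open>m\<close> by \<open>\<tau>\<^sup>m\<close>.\<close>

definition corresponds ::
    "complex ^ 'n ^ 3 \<Rightarrow> ('n::finite \<Rightarrow> nat) \<Rightarrow> ('n + 'n) cpoly \<Rightarrow> (int \<Rightarrow>\<^sub>0 3 cpoly) \<Rightarrow> bool"
  where "corresponds P v f F \<longleftrightarrow> (\<forall>x y. (\<forall>i. x i \<noteq> 0) \<longrightarrow>
    subst (case_sum x y) f =
    induced (subst (zval P x y)) (\<lambda>m. (\<Prod>i\<in>UNIV. x i ^ v i) powi (- m)) F)"

text \<open>The product over \<open>l \<noteq> i\<close> is the full product divided by
  \<open>x i\<close>. This restores the quotients \<open>y i / x i\<close>, on which the kernel acts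
  by translation.\<close>

lemma zval_eq:
  assumes "\<And>i. x i \<noteq> 0"
  shows "zval P x y k = (\<Prod>i\<in>UNIV. x i) * (\<Sum>i\<in>UNIV. P $ k $ i * (y i / x i))"
proof -
  have split: "(\<Prod>l\<in>UNIV. x l) = x i * (\<Prod>l\<in>-{i}. x l)" for i
    unfolding Compl_eq_Diff_UNIV by (rule prod.remove) auto
  have "P $ k $ i * (y i * (\<Prod>l\<in>-{i}. x l)) = (\<Prod>l\<in>UNIV. x l) * (P $ k $ i * (y i / x i))" for i
    by (subst split[of i]) (simp add: assms)
  then show ?thesis
    unfolding sum_distrib_left zval_def zform_def
    by (simp add: subst_sum subst_mult subst_prod scalar_complex_def)
qed

lemma prod_power_nonzero:
  fixes x :: "'n::finite \<Rightarrow> complex"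
  assumes "\<And>i. x i \<noteq> 0"
  shows "(\<Prod>i\<in>UNIV. x i ^ v i) \<noteq> 0"
  using assms by simp

text \<open>Evaluation at \<open>z = u\<close> and \<open>\<tau> = t\<close>; powers of the nonzero
  \<open>t\<close> turn sums of degrees into products.\<close>

lemma rees_eval_hom: "t \<noteq> 0 \<Longrightarrow> induced_hom (subst u) (\<lambda>m. (t::complex) powi (- m))"
  by standard (simp_all add: subst_add subst_mult power_int_diff power_int_minus divide_inverse)

section \<open>Compatibility of the correspondence with the algebra operations\<close>

lemma corresponds_add:
  "corresponds P v f F \<Longrightarrow> corresponds P v g G \<Longrightarrow> corresponds P v (f + g) (F + G)"
  unfolding corresponds_def
  by (simp add: subst_add induced_hom.add[OF rees_eval_hom[OF prod_power_nonzero]])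

lemma corresponds_mult:
  "corresponds P v f F \<Longrightarrow> corresponds P v g G \<Longrightarrow> corresponds P v (f * g) (F * G)"
  unfolding corresponds_def
  by (simp add: subst_mult induced_hom.mult[OF rees_eval_hom[OF prod_power_nonzero]])

lemma corresponds_0: "corresponds P v 0 0"
  unfolding corresponds_def
  by (simp add: induced_hom.zero[OF rees_eval_hom[OF prod_power_nonzero]])

lemma corresponds_sum:
  "(\<And>i. i \<in> A \<Longrightarrow> corresponds P v (f i) (F i)) \<Longrightarrow> corresponds P v (\<Sum>i\<in>A. f i) (\<Sum>i\<in>A. F i)"
  by (induction A rule: infinite_finite_induct) (simp_all add: corresponds_0 corresponds_add)

lemma corresponds_single:
  "corresponds P v f (single m h) \<longleftrightarrow> (\<forall>x y. (\<forall>i. x i \<noteq> 0) \<longrightarrow>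
    subst (case_sum x y) f = subst (zval P x y) h * (\<Prod>i\<in>UNIV. x i ^ v i) powi (- m))"
  unfolding corresponds_def
  by (simp add: induced_hom.single[OF rees_eval_hom[OF prod_power_nonzero]])

lemma corresponds_scalar: "corresponds P v (scalar a) (scalar a)"
  unfolding scalar_poly_mapping_def[where 'a = int] by (simp add: corresponds_single)

lemma case_sum_Inl_Inr: "a = case_sum (\<lambda>i. a (Inl i)) (\<lambda>i. a (Inr i))"
  by (auto simp: fun_eq_iff split: sum.split)

lemma poly_eq_on_x_torus:
  fixes f g :: "('n + 'n) cpoly"
  assumes "\<And>x y :: 'n \<Rightarrow> complex. (\<And>i. x i \<noteq> 0) \<Longrightarrow> subst (case_sum x y) f = subst (case_sum x y) g"
  shows "f = g"
proof (rule poly_eq_on_torus)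
  fix a :: "'n + 'n \<Rightarrow> complex" assume "\<And>i. a i \<noteq> 0"
  then show "subst a f = subst a g"
    using assms[of "\<lambda>i. a (Inl i)" "\<lambda>i. a (Inr i)"] by (simp flip: case_sum_Inl_Inr)
qed

lemma corresponds_left_unique: "corresponds P v f F \<Longrightarrow> corresponds P v g F \<Longrightarrow> f = g"
  by (rule poly_eq_on_x_torus) (simp add: corresponds_def)

text \<open>One coordinate is a \<open>v j\<close>-th root of \<open>t\<close>, the others are 1.
  Thus \<open>\<tau>\<close> takes every nonzero value.\<close>

lemma obtain_prod_power_eq:
  fixes v :: "'n::finite \<Rightarrow> nat"
  assumes "\<And>i. v i > 0" "t \<noteq> (0::complex)"
  obtains x where "\<And>i. x i \<noteq> 0" "(\<Prod>i\<in>UNIV. x i ^ v i) = t"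
proof -
  obtain j :: 'n where True by simp
  obtain c where c: "c ^ v j = t"
    using exists_complex_root[of "v j" t] assms(1)[of j] by auto
  have "(\<Prod>i\<in>UNIV. (if i = j then c else 1) ^ v i) = (\<Prod>i\<in>UNIV. if i = j then c ^ v j else 1)"
    by (intro prod.cong) auto
  then have "(\<Prod>i\<in>UNIV. (if i = j then c else 1) ^ v i) = t"
    using c by simp
  moreover have "c \<noteq> 0"
    using c assms(1)[of j] assms(2) by auto
  ultimately show ?thesis
    by (intro that[of "\<lambda>i. if i = j then c else 1"]) auto
qed

lemma right_inverse_apply:
  fixes P :: "complex ^ 'n::finite ^ 3"
  assumes "P ** S = mat 1"
  shows "(\<Sum>i\<in>UNIV. P $ k $ i * (\<Sum>l\<in>UNIV. S $ i $ l * u l)) = u k"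
proof -
  have "P *v (S *v (\<chi> l. u l)) = (\<chi> l. u l)"
    using assms by (simp add: matrix_vector_mul_assoc)
  from arg_cong[OF this, of "\<lambda>w. w $ k"] show ?thesis
    by (simp add: matrix_vector_mult_def)
qed

text \<open>The values of \<open>z\<close> and \<open>\<tau>\<close> can be prescribed
  independently, so \<open>F\<close> and \<open>G\<close> agree at all \<open>u\<close> and all
  \<open>t \<noteq> 0\<close>. Independence of the powers of \<open>t\<close> separates the
  components, which then agree as polynomials.\<close>

lemma corresponds_right_unique:
  fixes P :: "complex ^ 'n::finite ^ 3"
  assumes S: "P ** S = mat 1" and v: "\<And>i. v i > 0"
    and F: "corresponds P v f F" and G: "corresponds P v f G"
  shows "F = G"
proof -
  have zero: "induced (subst u) (\<lambda>m. t powi (- m)) (F - G) = 0"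
    if t: "t \<noteq> 0" for u and t :: complex
  proof -
    obtain x where x: "\<And>i. x i \<noteq> 0" and xv: "(\<Prod>i\<in>UNIV. x i ^ v i) = t"
      using obtain_prod_power_eq[of v, OF v t] by blast
    define X where "X = (\<Prod>i\<in>UNIV. x i)"
    have X: "X \<noteq> 0" using x by (simp add: X_def)
    \<comment> \<open>The vector of the \<open>y i / x i\<close> is \<open>S u / X\<close>, which
      \<open>P\<close> maps to \<open>u / X\<close>; the factor \<open>X\<close> in
      \<open>zval_eq\<close> restores \<open>u\<close>.\<close>
    define y where "y i = x i * ((\<Sum>l\<in>UNIV. S $ i $ l * u l) / X)" for i
    have "zval P x y k = u k" for k
    proof -
      have "zval P x y k = X * (\<Sum>i\<in>UNIV. P $ k $ i * (y i / x i))"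
        using x by (simp add: zval_eq X_def)
      also have "(\<Sum>i\<in>UNIV. P $ k $ i * (y i / x i)) =
          (\<Sum>i\<in>UNIV. P $ k $ i * (\<Sum>l\<in>UNIV. S $ i $ l * u l)) / X"
        unfolding sum_divide_distrib[of _ _ X] using x by (intro sum.cong) (simp_all add: y_def)
      finally show ?thesis
        using X by (simp add: right_inverse_apply[OF S])
    qed
    then have "zval P x y = u" by blast
    then have "induced (subst u) (\<lambda>m. t powi (- m)) F = induced (subst u) (\<lambda>m. t powi (- m)) G"
      using F[unfolded corresponds_def, rule_format, of x y]
        G[unfolded corresponds_def, rule_format, of x y] x xv by simp
    then show ?thesis
      by (simp add: induced_hom.minus[OF rees_eval_hom[OF t]])
  qed
  have "lookup (F - G) m = 0" if "m \<in> keys (F - G)" for m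
  proof (rule poly_eq_on_torus)
    fix u :: "3 \<Rightarrow> complex"
    have "\<forall>m\<in>keys (F - G). subst u (lookup (F - G) m) = 0"
      using zero by (intro laurent_independent) (simp_all add: induced_def)
    with that show "subst u (lookup (F - G) m) = subst u 0" by simp
  qed
  then have "keys (F - G) = {}"
    using in_keys_iff by blast
  then show ?thesis
    by (simp only: keys_eq_empty right_minus_eq)
qed

section \<open>Invariance\<close>

lemma subst_sigma:
  "subst (case_sum x y) (sigma c b f) =
    subst (case_sum (\<lambda>i. c $ i * x i) (\<lambda>i. c $ i / (\<Prod>j\<in>UNIV. c $ j) * (y i + b $ i * x i))) f"
proof -
  have "(\<lambda>i. subst (case_sum x y) (case_sum (\<lambda>i. scalar (c $ i) * Var (Inl i))
        (\<lambda>i. scalar (c $ i / (\<Prod>j\<in>UNIV. c $ j)) * (Var (Inr i) + scalar (b $ i) * Var (Inl i))) i)) =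
      case_sum (\<lambda>i. c $ i * x i) (\<lambda>i. c $ i / (\<Prod>j\<in>UNIV. c $ j) * (y i + b $ i * x i))"
    by (auto simp: fun_eq_iff subst_mult subst_add scalar_complex_def split: sum.split)
  then show ?thesis
    unfolding sigma_def subst_subst by simp
qed

text \<open>With \<open>C\<close> the product of the \<open>c $ i\<close>, the quotients
  \<open>y i / x i\<close> become \<open>(y i / x i + b $ i) / C\<close>, the product of the
  \<open>x i\<close> gains the factor \<open>C\<close>, and \<open>P\<close> kills the shift by
  \<open>b\<close>.\<close>

lemma zval_sigma:
  fixes P :: "complex ^ 'n::finite ^ 3"
  assumes x: "\<And>i. x i \<noteq> 0" and c: "\<And>i. c $ i \<noteq> 0" and b: "b \<in> kernel P"
  shows "zval P (\<lambda>i. c $ i * x i) (\<lambda>i. c $ i / (\<Prod>j\<in>UNIV. c $ j) * (y i + b $ i * x i)) = zval P x y"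
proof
  fix k
  define C where "C = (\<Prod>j\<in>UNIV. c $ j)"
  have C: "C \<noteq> 0" using c by (simp add: C_def)
  have b0: "(\<Sum>i\<in>UNIV. P $ k $ i * b $ i) = 0"
  proof -
    have "(P *v b) $ k = 0"
      using b by (simp add: kernel_def)
    then show ?thesis
      by (simp add: matrix_vector_mult_def)
  qed
  have "(\<Sum>i\<in>UNIV. P $ k $ i * ((c $ i / C * (y i + b $ i * x i)) / (c $ i * x i))) =
      (\<Sum>i\<in>UNIV. (P $ k $ i * (y i / x i) + P $ k $ i * b $ i) / C)"
    using x c C by (intro sum.cong) (simp_all add: field_simps)
  also have "\<dots> = (\<Sum>i\<in>UNIV. P $ k $ i * (y i / x i)) / C"
    by (simp add: b0 sum.distrib flip: sum_divide_distrib)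
  finally show "zval P (\<lambda>i. c $ i * x i) (\<lambda>i. c $ i / (\<Prod>j\<in>UNIV. c $ j) * (y i + b $ i * x i)) k = zval P x y k"
    using x c C by (simp add: zval_eq prod.distrib flip: C_def)
qed

text \<open>\<open>z\<close> is fixed by \<open>zval_sigma\<close>; \<open>\<tau>\<close> is
  multiplied by the product of the \<open>(c $ i) ^ v i\<close>, which is 1 on the torus.\<close>

lemma corresponds_imp_invariant:
  fixes P :: "complex ^ 'n::finite ^ 3"
  assumes "corresponds P v f F"
  shows "f \<in> invariants (sigma_group P v)"
proof -
  have "sigma c b f = f" if c: "c \<in> torus v" and b: "b \<in> kernel P" for c b
  proof (rule poly_eq_on_x_torus)
    fix x y :: "'n \<Rightarrow> complex" assume x: "\<And>i. x i \<noteq> 0"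
    have c0: "\<And>i. c $ i \<noteq> 0" and c1: "(\<Prod>i\<in>UNIV. (c $ i) ^ v i) = 1"
      using c by (auto simp: torus_def)
    show "subst (case_sum x y) (sigma c b f) = subst (case_sum x y) f"
      using assms x c0 c1 zval_sigma[of x c b P y, OF x c0 b] unfolding subst_sigma corresponds_def
      by (simp add: power_mult_distrib prod.distrib)
  qed
  then show ?thesis
    by (auto simp: invariants_def sigma_group_def)
qed

text \<open>The exponent of \<open>c\<^sub>i\<close> in the factor by which the torus scales the
  monomial \<open>\<mu>\<close>. The subtracted sum comes from the denominator that each
  \<open>y\<^sub>j\<close> receives.\<close>

definition weight :: "('n::finite + 'n \<Rightarrow>\<^sub>0 nat) \<Rightarrow> 'n \<Rightarrow> int"
  where "weight \<mu> i =
    int (lookup \<mu> (Inl i)) + int (lookup \<mu> (Inr i)) - (\<Sum>j\<in>UNIV. int (lookup \<mu> (Inr j)))"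

lemma monomial_case_sum:
  fixes a b :: "'n::finite \<Rightarrow> 'a::comm_ring_1"
  shows "monomial (case_sum a b) \<mu> =
    (\<Prod>i\<in>UNIV. a i ^ lookup \<mu> (Inl i)) * (\<Prod>i\<in>UNIV. b i ^ lookup \<mu> (Inr i))"
  by (simp add: monomial_UNIV prod.Plus flip: UNIV_Plus_UNIV)

lemma prod_power_int: "(\<Prod>i\<in>A. f i powi n) = (\<Prod>i\<in>A. f i :: complex) powi n"
  by (induction A rule: infinite_finite_induct) (simp_all add: power_int_mult_distrib)

lemma monomial_scale:
  fixes c :: "'n::finite \<Rightarrow> complex"
  assumes c: "\<And>i. c i \<noteq> 0"
  shows "monomial (case_sum (\<lambda>i. c i * a i) (\<lambda>i. c i / (\<Prod>j\<in>UNIV. c j) * b i)) \<mu> =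
    (\<Prod>i\<in>UNIV. c i powi weight \<mu> i) * monomial (case_sum a b) \<mu>"
proof -
  define C where "C = (\<Prod>j\<in>UNIV. c j)"
  define B where "B = (\<Sum>j\<in>UNIV. lookup \<mu> (Inr j))"
  have C: "C \<noteq> 0" using c by (simp add: C_def)
  have "c i powi weight \<mu> i = c i ^ lookup \<mu> (Inl i) * c i ^ lookup \<mu> (Inr i) * c i powi (- int B)" for i
    using c[of i] by (simp add: weight_def B_def power_int_diff power_int_add power_int_minus field_simps
        flip: of_nat_sum)
  then have "(\<Prod>i\<in>UNIV. c i powi weight \<mu> i) =
      (\<Prod>i\<in>UNIV. c i ^ lookup \<mu> (Inl i)) * (\<Prod>i\<in>UNIV. c i ^ lookup \<mu> (Inr i)) * C powi (- int B)"
    by (simp add: prod.distrib prod_power_int C_def)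
  moreover have "(\<Prod>i\<in>UNIV. C ^ lookup \<mu> (Inr i)) = C ^ B"
    by (simp add: B_def power_sum)
  ultimately show ?thesis
    using C unfolding monomial_case_sum C_def[symmetric]
    by (simp add: power_mult_distrib power_divide prod.distrib prod_dividef power_int_minus field_simps)
qed

text \<open>For \<open>b = 0\<close> the action scales each monomial separately, so comparing
  coefficients in \<open>sigma c 0 f = f\<close> forces every factor to be 1.\<close>

lemma weight_eq_1_on_torus:
  fixes P :: "complex ^ 'n::finite ^ 3"
  assumes f: "f \<in> invariants (sigma_group P v)" and \<mu>: "\<mu> \<in> keys f" and c: "c \<in> torus v"
  shows "(\<Prod>i\<in>UNIV. (c $ i) powi weight \<mu> i) = 1"
proof -
  have c0: "\<And>i. c $ i \<noteq> 0"
    using c by (auto simp: torus_def)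
  have "0 \<in> kernel P"
    by (simp add: kernel_def)
  with f c have inv: "sigma c 0 f = f"
    by (auto simp: invariants_def sigma_group_def)
  have "\<forall>\<mu>\<in>keys f. lookup f \<mu> * ((\<Prod>i\<in>UNIV. (c $ i) powi weight \<mu> i) - 1) = 0"
  proof (rule monomials_independent)
    fix a :: "'n + 'n \<Rightarrow> complex"
    let ?x = "\<lambda>i. a (Inl i)" and ?y = "\<lambda>i. a (Inr i)"
    have "subst (case_sum ?x ?y) (sigma c 0 f) = subst (case_sum ?x ?y) f"
      by (simp add: inv)
    then have "(\<Sum>\<mu>\<in>keys f. lookup f \<mu> * ((\<Prod>i\<in>UNIV. (c $ i) powi weight \<mu> i) * monomial (case_sum ?x ?y) \<mu>))
        = (\<Sum>\<mu>\<in>keys f. lookup f \<mu> * monomial (case_sum ?x ?y) \<mu>)"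
      unfolding subst_sigma by (simp add: subst_complex_alt monomial_scale c0 del: times_divide_eq_left)
    then show "(\<Sum>\<mu>\<in>keys f. lookup f \<mu> * ((\<Prod>i\<in>UNIV. (c $ i) powi weight \<mu> i) - 1) * monomial a \<mu>) = 0"
      by (simp add: algebra_simps sum_subtractf flip: case_sum_Inl_Inr)
  qed simp
  with \<mu> show ?thesis by (simp add: in_keys_iff)
qed

text \<open>The weight is a character trivial on \<open>torus v\<close>, hence a multiple of
  \<open>v\<close>. With torus elements written as exponentials, roots of unity give divisibility
  and positive real elements give proportionality.\<close>

lemma weight_multiple:
  fixes P :: "complex ^ 'n::finite ^ 3"
  assumes f: "f \<in> invariants (sigma_group P v)" and \<mu>: "\<mu> \<in> keys f" and v: "\<And>i. v i > 0"
  shows "\<exists>m. \<forall>i. weight \<mu> i = - m * int (v i)"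
proof -
  have exp_1: "exp (\<Sum>i\<in>UNIV. of_int (weight \<mu> i) * a i) = 1"
    if "exp (\<Sum>i\<in>UNIV. of_nat (v i) * a i) = 1" for a :: "'n \<Rightarrow> complex"
  proof -
    have "(\<chi> i. exp (a i)) \<in> torus v"
      using that by (simp add: torus_def exp_sum exp_of_nat_mult)
    from weight_eq_1_on_torus[OF f \<mu> this] show ?thesis
      by (simp add: exp_sum exp_power_int)
  qed
  have div: "int (v j) dvd weight \<mu> j" for j
  proof -
    \<comment> \<open>Its exponential is a primitive \<open>v j\<close>-th root of unity in
      coordinate \<open>j\<close> and 1 elsewhere.\<close>
    let ?a = "\<lambda>i. if i = j then of_real (2 * pi) * \<i> / of_nat (v j) else 0"
    have "exp (\<Sum>i\<in>UNIV. of_int (weight \<mu> i) * ?a i) = 1"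
      by (rule exp_1) (use v[of j] in \<open>simp add: if_distrib[of "\<lambda>x. _ * x"] cong: if_cong\<close>)
    then have "exp (\<i> * of_real (2 * pi * (weight \<mu> j / v j))) = 1"
      by (simp add: if_distrib[of "\<lambda>x. _ * x"] field_simps cong: if_cong)
    then obtain n :: int where "2 * pi * (weight \<mu> j / v j) = of_int (2 * n) * pi"
      unfolding exp_eq_1 by auto
    then have "real_of_int (weight \<mu> j) = n * v j"
      using v[of j] by (simp add: field_simps)
    then have "weight \<mu> j = n * int (v j)"
      by (metis of_int_eq_iff of_int_mult of_int_of_nat_eq)
    then show ?thesis by simp
  qed
  have eq: "weight \<mu> i / v i = weight \<mu> j / v j" for i j
  proof -
    \<comment> \<open>The sum of the \<open>v l * ?a l\<close> is 0. As the entries are real, an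
      exponential equal to 1 forces the exponent to be 0.\<close>
    let ?a = "\<lambda>l. (if l = i then 1 / complex_of_nat (v i) else 0) - (if l = j then 1 / complex_of_nat (v j) else 0)"
    have "exp (\<Sum>l\<in>UNIV. of_int (weight \<mu> l) * ?a l) = 1"
      by (rule exp_1) (use v[of i] v[of j] in \<open>simp add: right_diff_distrib sum_subtractf
          if_distrib[of "\<lambda>x. _ * x"] cong: if_cong\<close>)
    then have "exp (complex_of_real (weight \<mu> i / v i - weight \<mu> j / v j)) = 1"
      by (simp add: right_diff_distrib sum_subtractf if_distrib[of "\<lambda>x. _ * x"] cong: if_cong)
    then show ?thesis
      unfolding exp_eq_1 by simp
  qed
  obtain j :: 'n where True by simp
  obtain m where m: "weight \<mu> j = int (v j) * m"
    using div by blast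
  have "weight \<mu> i = m * int (v i)" for i
  proof -
    have "real_of_int (weight \<mu> i) = real_of_int (m * int (v i))"
      using eq[of i j] v[of i] v[of j] by (simp add: m field_simps)
    then show ?thesis by (simp only: of_int_eq_iff)
  qed
  \<comment> \<open>The sign is that of \<open>F\<^sub>m(z) / \<tau>\<^sup>m\<close>, which has
    weight \<open>- m * v i\<close>.\<close>
  then show ?thesis by (intro exI[of _ "- m"]) simp
qed

text \<open>All monomials scale by the same factor. Here \<open>c\<close> is any vector with nonzero
  entries, not only one in \<open>torus v\<close>, so that different \<open>m\<close> can be told
  apart.\<close>

lemma subst_scale:
  fixes c :: "'n::finite \<Rightarrow> complex"
  assumes c: "\<And>i. c i \<noteq> 0" and f: "\<And>\<mu> i. \<mu> \<in> keys f \<Longrightarrow> weight \<mu> i = - m * int (v i)"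
  shows "subst (case_sum (\<lambda>i. c i * a i) (\<lambda>i. c i / (\<Prod>j\<in>UNIV. c j) * b i)) f =
    (\<Prod>i\<in>UNIV. c i ^ v i) powi (- m) * subst (case_sum a b) f"
proof -
  have "(\<Prod>i\<in>UNIV. c i powi weight \<mu> i) = (\<Prod>i\<in>UNIV. c i ^ v i) powi (- m)" if "\<mu> \<in> keys f" for \<mu>
    using f[OF that] by (simp add: prod_power_int[symmetric] power_int_mult[symmetric] mult.commute
        flip: power_int_of_nat)
  then show ?thesis
    unfolding subst_complex_alt monomial_scale[of c, OF c] sum_distrib_left
    by (intro sum.cong refl) simp
qed

text \<open>Translating \<open>y\<close> by an element of the kernel, an invariant \<open>f\<close> can be evaluated at a point
  that depends only on \<open>x\<close> and \<open>z\<close>; the torus action then separates the weight components of \<open>f\<close>.\<close>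

lemma invariant_components:
  fixes P :: "complex ^ 'n::finite ^ 3"
  assumes S: "P ** S = mat 1" and v: "\<And>i. v i > 0" and f: "f \<in> invariants (sigma_group P v)"
  obtains T g h where "finite T" "f = (\<Sum>m\<in>T. g m)" "\<And>m. m \<in> T \<Longrightarrow> corresponds P v (g m) (single m (h m))"
proof -
  obtain M where M: "\<And>\<mu> i. \<mu> \<in> keys f \<Longrightarrow> weight \<mu> i = - M \<mu> * int (v i)"
    using weight_multiple[OF f _ v] by metis
  define T where "T = M ` keys f"
  define g where "g m = restrict_keys (\<lambda>\<mu>. M \<mu> = m) f" for m
  \<comment> \<open>\<open>L\<close> is a section of \<open>z\<close> where all
    \<open>x\<^sub>i\<close> are 1: there \<open>z = P y\<close>, and \<open>y = S u\<close> gives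
    \<open>z = u\<close>. \<open>h m\<close> is \<open>g m\<close> restricted to this
    section.\<close>
  define L :: "'n \<Rightarrow> 3 cpoly" where "L i = (\<Sum>l\<in>UNIV. scalar (S $ i $ l) * Var l)" for i
  define h where "h m = subst (case_sum (\<lambda>_. 1) L) (g m)" for m
  have f_eq: "f = (\<Sum>m\<in>T. g m)"
    unfolding g_def by (rule sum_restrict_keys[symmetric]) (simp_all add: T_def)
  have scale: "subst (case_sum (\<lambda>i. c i * a i) (\<lambda>i. c i / (\<Prod>j\<in>UNIV. c j) * b i)) (g m) =
      (\<Prod>i\<in>UNIV. c i ^ v i) powi (- m) * subst (case_sum a b) (g m)" if "\<And>i. c i \<noteq> 0" for c a b :: "'n \<Rightarrow> complex" and m
    by (rule subst_scale[of c "g m" m v a b]) (use that M in \<open>auto simp: g_def keys_restrict_keys\<close>)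
  have h: "subst u (h m) = subst (case_sum (\<lambda>_. 1) (\<lambda>i. \<Sum>l\<in>UNIV. S $ i $ l * u l)) (g m)"
    for u :: "3 \<Rightarrow> complex" and m
  proof -
    have "(\<lambda>i. subst u (case_sum (\<lambda>_::'n. 1) L i)) = case_sum (\<lambda>_. 1) (\<lambda>i. \<Sum>l\<in>UNIV. S $ i $ l * u l)"
      by (auto simp: fun_eq_iff L_def subst_sum subst_mult scalar_complex_def split: sum.split)
    then show ?thesis
      unfolding h_def subst_subst by simp
  qed
  have expand: "subst (case_sum x y) f = (\<Sum>m\<in>T. (\<Prod>i\<in>UNIV. x i ^ v i) powi (- m) * subst (zval P x y) (h m))"
    if x: "\<And>i. x i \<noteq> 0" for x y
  proof -
    define X where "X = (\<Prod>i\<in>UNIV. x i)"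
    have X: "X \<noteq> 0" using x by (simp add: X_def)
    define w where "w i = (\<Sum>l\<in>UNIV. S $ i $ l * zval P x y l)" for i
    \<comment> \<open>This moves \<open>y i / x i\<close> to \<open>w i / X\<close>. Both vectors
      have the image \<open>zval P x y / X\<close> under \<open>P\<close>, so \<open>b\<close> lies
      in the kernel.\<close>
    define b where "b = (\<chi> i. w i / X - y i / x i)"
    have "(P *v b) $ k = 0" for k
    proof -
      have "(P *v b) $ k = (\<Sum>i\<in>UNIV. P $ k $ i * w i) / X - (\<Sum>i\<in>UNIV. P $ k $ i * (y i / x i))"
        by (simp add: b_def matrix_vector_mult_def right_diff_distrib sum_subtractf sum_divide_distrib)
      also have "(\<Sum>i\<in>UNIV. P $ k $ i * w i) = zval P x y k"
        unfolding w_def by (rule right_inverse_apply[OF S])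
      finally show ?thesis
        using X x by (simp add: zval_eq flip: X_def)
    qed
    then have "b \<in> kernel P"
      by (simp add: kernel_def vec_eq_iff)
    moreover have "(\<chi> i. 1) \<in> torus v"
      by (simp add: torus_def)
    ultimately have "sigma (\<chi> i. 1) b f = f"
      using f by (auto simp: invariants_def sigma_group_def)
    then have "subst (case_sum x y) f = subst (case_sum x (\<lambda>i. y i + b $ i * x i)) f"
      using subst_sigma[of x y "\<chi> i. 1" b f] by simp
    also have "(\<lambda>i. y i + b $ i * x i) = (\<lambda>i. x i / X * w i)"
      using x X by (auto simp: b_def field_simps)
    also have "subst (case_sum x (\<lambda>i. x i / X * w i)) f =
        (\<Sum>m\<in>T. subst (case_sum x (\<lambda>i. x i / X * w i)) (g m))"
      by (subst f_eq) (simp add: subst_sum)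
    \<comment> \<open>The point reached is the one with all \<open>x\<^sub>i\<close> equal to 1 and
      \<open>y = w\<close>, scaled by \<open>c = x\<close>.\<close>
    also have "\<dots> = (\<Sum>m\<in>T. (\<Prod>i\<in>UNIV. x i ^ v i) powi (- m) * subst (zval P x y) (h m))"
      using scale[of x "\<lambda>_. 1" w] x unfolding h w_def[symmetric] by (simp add: X_def)
    finally show ?thesis .
  qed
  have "corresponds P v (g m) (single m (h m))" if "m \<in> T" for m
    unfolding corresponds_single
  proof (intro allI impI)
    fix x y :: "'n \<Rightarrow> complex" assume "\<forall>i. x i \<noteq> 0"
    then have x: "\<And>i. x i \<noteq> 0" by blast
    let ?\<tau> = "\<Prod>i\<in>UNIV. x i ^ v i"
    \<comment> \<open>Scaling by \<open>c\<close> with \<open>\<tau>(c) = t\<close> fixes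
      \<open>z\<close> and multiplies \<open>\<tau>\<close> by \<open>t\<close>. Two expansions of
      \<open>f\<close> at the scaled point are compared as Laurent polynomials in
      \<open>t\<close>.\<close>
    have "\<forall>m\<in>T. subst (case_sum x y) (g m) - ?\<tau> powi (- m) * subst (zval P x y) (h m) = 0"
    proof (rule laurent_independent)
      fix t :: complex assume "t \<noteq> 0"
      then obtain c where c: "\<And>i. c i \<noteq> 0" and ct: "(\<Prod>i\<in>UNIV. c i ^ v i) = t"
        using obtain_prod_power_eq[of v, OF v] by blast
      let ?x = "\<lambda>i. c i * x i" and ?y = "\<lambda>i. c i / (\<Prod>j\<in>UNIV. c j) * y i"
      have z: "zval P ?x ?y = zval P x y"
        using zval_sigma[of x "\<chi> i. c i" 0 P y] x c by (simp add: kernel_def)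
      have "(\<Sum>m\<in>T. t powi (- m) * subst (case_sum x y) (g m)) = subst (case_sum ?x ?y) f"
        by (subst f_eq) (simp add: subst_sum scale c ct del: times_divide_eq_left)
      also have "\<dots> = (\<Sum>m\<in>T. (t * ?\<tau>) powi (- m) * subst (zval P x y) (h m))"
        using expand[of ?x ?y] x c unfolding z by (simp add: power_mult_distrib prod.distrib ct)
      finally show "(\<Sum>m\<in>T. (subst (case_sum x y) (g m) - ?\<tau> powi (- m) * subst (zval P x y) (h m)) * t powi (- m)) = 0"
        by (simp add: right_diff_distrib sum_subtractf power_int_mult_distrib mult_ac)
    qed (simp add: T_def)
    with that show "subst (case_sum x y) (g m) = subst (zval P x y) (h m) * ?\<tau> powi (- m)"
      by (simp add: mult.commute)
  qed
  with f_eq show ?thesis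
    by (intro that[of T g h]) (simp_all add: T_def)
qed

section \<open>Fat point ideals and divisibility\<close>

lemma fat_ideal_iff:
  fixes P :: "complex ^ 'n::finite ^ 3"
  assumes k: "\<And>j. P $ k j $ j \<noteq> 0"
  shows "h \<in> fat_ideal P v m \<longleftrightarrow>
    (\<forall>j. subst (to_coord (column j P) (k j)) h \<in> order_ge (off (k j)) (nat (m * int (v j))))"
proof -
  have "\<And>j. column j P $ k j \<noteq> 0"
    using k by (simp add: column_def)
  from ideal_power_point_ideal[OF this] show ?thesis
    by (simp add: fat_ideal_def)
qed

lemma power_single_nat: "single (a :: nat) (r :: 'b::comm_ring_1) ^ n = single (a * n) (r ^ n)"
  by (induction n) (simp_all add: mult_single)

text \<open>With \<open>\<epsilon> = single 1 1\<close>, the variable \<open>i\<close> receives the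
  factor \<open>\<epsilon> ^ w i\<close>, so the power of \<open>\<epsilon>\<close> records the
  weight.\<close>

lemma subst_weight_variables:
  "subst (\<lambda>i. single (w i) (Var i)) f = (\<Sum>\<mu>\<in>keys f. single (wdeg w \<mu>) (single \<mu> (lookup f \<mu>)))"
  for f :: "'v cpoly"
proof -
  have "monomial (\<lambda>i. single (w i) (Var i)) \<mu> = single (wdeg w \<mu>) (single \<mu> 1 :: 'v cpoly)" for \<mu>
  proof -
    have "(\<Prod>i\<in>A. single (a i) (g i)) = single (\<Sum>i\<in>A. a i) (\<Prod>i\<in>A. g i)"
      for A and a :: "'v \<Rightarrow> nat" and g :: "'v \<Rightarrow> 'v cpoly"
      by (induction A rule: infinite_finite_induct) (simp_all add: mult_single)
    then show ?thesis
      by (simp add: monomial_def wdeg_def power_single_nat flip: monomial_Var)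
  qed
  then show ?thesis
    by (simp add: subst_alt scalar_poly_mapping_def mult_single scalar_complex_def)
qed

text \<open>A multiple of \<open>single K 1\<close> has no coefficient below \<open>K\<close>,
  whereas a monomial \<open>\<mu>\<close> of \<open>f\<close> would leave one at
  \<open>wdeg w \<mu>\<close>.\<close>

lemma order_ge_if_weight_divides:
  assumes "subst (\<lambda>i. single (w i) (Var i)) f = G * single K 1"
  shows "f \<in> order_ge w K"
  unfolding order_ge_def
proof (intro CollectI ballI leI notI)
  fix \<mu> assume \<mu>: "\<mu> \<in> keys f" and less: "wdeg w \<mu> < K"
  have "lookup (G * single K 1) (wdeg w \<mu>) = 0"
    using less by (subst poly_mapping_mult_expand) (simp add: lookup_sum lookup_single when_def)
  then have "lookup (lookup (subst (\<lambda>i. single (w i) (Var i)) f) (wdeg w \<mu>)) \<mu> = 0"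
    by (simp add: assms)
  also have "lookup (lookup (subst (\<lambda>i. single (w i) (Var i)) f) (wdeg w \<mu>)) \<mu> =
      (\<Sum>\<nu>\<in>keys f. if \<nu> = \<mu> then lookup f \<nu> else 0)"
    unfolding subst_weight_variables lookup_sum
    by (intro sum.cong) (auto simp: lookup_single when_def)
  finally show False
    using \<mu> by (simp add: in_keys_iff)
qed

text \<open>Clears the denominator \<open>\<tau>\<^sup>m\<close>; agreement where no
  \<open>x\<^sub>i\<close> vanishes is an identity of polynomials.\<close>

lemma corresponds_single_nonneg:
  assumes "corresponds P v g (single m h)" "m \<ge> 0"
  shows "subst (zform P) h = g * (\<Prod>i\<in>UNIV. Var (Inl i) ^ (nat m * v i))"
proof (rule poly_eq_on_x_torus)
  fix x y :: "'a \<Rightarrow> complex" assume x: "\<And>i. x i \<noteq> 0"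
  let ?\<tau> = "\<Prod>i\<in>UNIV. x i ^ v i"
  have "?\<tau> powi m = ?\<tau> ^ nat m"
    using \<open>m \<ge> 0\<close> by (simp add: power_int_def)
  also have "\<dots> = (\<Prod>i\<in>UNIV. x i ^ (nat m * v i))"
    by (simp add: prod_power_distrib mult.commute flip: power_mult)
  finally have "(\<Prod>i\<in>UNIV. x i ^ (nat m * v i)) = ?\<tau> powi m" ..
  moreover have "subst (case_sum x y) g = subst (zval P x y) h * ?\<tau> powi (- m)"
    using assms x by (simp add: corresponds_single)
  moreover have "subst (case_sum x y) (subst (zform P) h) = subst (zval P x y) h"
    by (simp add: subst_subst flip: zval_def)
  ultimately show "subst (case_sum x y) (subst (zform P) h) =
      subst (case_sum x y) (g * (\<Prod>i\<in>UNIV. Var (Inl i) ^ (nat m * v i)))"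
    using prod_power_nonzero[of x v, OF x] by (simp add: subst_mult subst_prod subst_power power_int_minus)
qed

text \<open>The substitution \<open>x\<^sub>j \<mapsto> \<epsilon>\<close>, \<open>x\<^sub>i \<mapsto> 1\<close> for \<open>i \<noteq> j\<close>, together with a suitable choice of the
  \<open>y\<^sub>i\<close>, sends \<open>z\<close> to a generic point \<open>\<lambda> p\<^sub>j + \<epsilon> w\<close>. Divisibility by powers of \<open>x\<^sub>j\<close> thus
  becomes vanishing at \<open>p\<^sub>j\<close>. Polynomials in \<open>\<epsilon>\<close> are families indexed by \<open>nat\<close>.\<close>

lemma subst_zform_near_point:
  fixes P :: "complex ^ 'n::finite ^ 3" and j :: 'n and k :: 3
  assumes S: "P ** S = mat 1" and k: "P $ k $ j \<noteq> 0"
  obtains \<theta> :: "'n + 'n \<Rightarrow> nat \<Rightarrow>\<^sub>0 3 cpoly" where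
    "\<And>i. \<theta> (Inl i) = (if i = j then single 1 1 else 1)"
    "\<And>l. subst \<theta> (zform P l) = subst (\<lambda>i. single (off k i) (Var i)) (to_coord (column j P) k l)"
proof -
  \<comment> \<open>\<open>W\<close> is the first summand of \<open>to_coord\<close>,
    \<open>a\<close> is \<open>S W\<close>, so that \<open>P a = W\<close>, and \<open>lam\<close>
    times column \<open>j\<close> is the second summand.\<close>
  define W :: "3 \<Rightarrow> 3 cpoly" where "W l = (if l = k then 0 else Var l)" for l
  define a where "a i = (\<Sum>l\<in>UNIV. scalar (S $ i $ l) * W l)" for i
  define lam :: "3 cpoly" where "lam = scalar (1 / P $ k $ j) * Var k"
  \<comment> \<open>In \<open>zform\<close>, the product of the \<open>x\<^sub>l\<close> supplies a
    factor \<open>\<epsilon>\<close> to every term except that of \<open>y\<^sub>j\<close>. There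
    \<open>\<epsilon>\<close> is put in by hand, next to \<open>lam\<close>, which survives at
    \<open>\<epsilon> = 0\<close>.\<close>
  define \<theta> :: "'n + 'n \<Rightarrow> nat \<Rightarrow>\<^sub>0 3 cpoly" where
    "\<theta> = case_sum (\<lambda>i. if i = j then single 1 1 else 1)
      (\<lambda>i. if i = j then single 0 lam + single 1 (a i) else single 0 (a i))"
  have sc: "scalar c = (single 0 (scalar c) :: nat \<Rightarrow>\<^sub>0 3 cpoly)" for c
    by (simp add: scalar_poly_mapping_def[where 'a = nat])
  have Pa: "(\<Sum>i\<in>UNIV. scalar (P $ l $ i) * a i) = W l" for l
  proof -
    have "(\<Sum>i\<in>UNIV. scalar (P $ l $ i) * a i) =
        (\<Sum>i\<in>UNIV. \<Sum>l'\<in>UNIV. scalar (P $ l $ i * S $ i $ l') * W l')"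
      by (simp add: a_def sum_distrib_left scalar_mult mult.assoc)
    also have "\<dots> = (\<Sum>l'\<in>UNIV. scalar ((P ** S) $ l $ l') * W l')"
      by (subst sum.swap) (simp add: matrix_matrix_mult_def scalar_sum sum_distrib_right)
    also have "\<dots> = (\<Sum>l'\<in>UNIV. if l' = l then W l' else 0)"
      unfolding S by (intro sum.cong) (auto simp: mat_def scalar_0 scalar_one)
    finally show ?thesis by simp
  qed
  have "subst \<theta> (zform P l) = subst (\<lambda>i. single (off k i) (Var i)) (to_coord (column j P) k l)" for l
  proof -
    have prod_eq: "(\<Prod>l\<in>-{i}. \<theta> (Inl l)) = (if i = j then 1 else single 1 1)" for i
    proof (cases "i = j")
      case True
      then show ?thesis by (auto simp: \<theta>_def intro!: prod.neutral)
    next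
      case False
      have "(\<Prod>l\<in>-{i}. \<theta> (Inl l)) = (\<Prod>l\<in>{j}. \<theta> (Inl l))"
        using False by (intro prod.mono_neutral_right) (auto simp: \<theta>_def)
      with False show ?thesis by (simp add: \<theta>_def)
    qed
    have term_eq: "\<theta> (Inr i) * (\<Prod>l\<in>-{i}. \<theta> (Inl l)) = (if i = j then single 0 lam else 0) + single 1 (a i)" for i
      unfolding prod_eq by (simp add: \<theta>_def mult_single)
    have "subst \<theta> (zform P l) = (\<Sum>i\<in>UNIV. single 0 (scalar (P $ l $ i)) *
        ((if i = j then single 0 lam else 0) + single 1 (a i)))"
      unfolding zform_def by (simp add: subst_sum subst_mult subst_prod sc term_eq)
    also have "\<dots> = (\<Sum>i\<in>UNIV. (if i = j then single 0 (scalar (P $ l $ i) * lam) else 0) +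
        single 1 (scalar (P $ l $ i) * a i))"
      by (intro sum.cong) (simp_all add: distrib_left mult_single)
    also have "\<dots> = single 0 (scalar (P $ l $ j) * lam) + single 1 (\<Sum>i\<in>UNIV. scalar (P $ l $ i) * a i)"
    proof -
      have "single 1 (\<Sum>i\<in>A. g i) = (\<Sum>i\<in>A. single (1 :: nat) (g i))" for A and g :: "'n \<Rightarrow> 3 cpoly"
        by (induction A rule: infinite_finite_induct) (simp_all add: single_add)
      then show ?thesis by (simp add: sum.distrib)
    qed
    also have "\<dots> = single 0 (scalar (P $ l $ j / P $ k $ j) * Var k) + single 1 (W l)"
      unfolding Pa by (simp add: lam_def scalar_mult[symmetric] mult.assoc[symmetric])
    also have "\<dots> = subst (\<lambda>i. single (off k i) (Var i)) (to_coord (column j P) k l)"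
      by (simp add: to_coord_def subst_add subst_mult off_def W_def column_def sc mult_single)
    finally show ?thesis .
  qed
  then show ?thesis
    by (intro that[of \<theta>]) (simp_all add: \<theta>_def)
qed

text \<open>Under the substitution near \<open>p\<^sub>j\<close>, \<open>\<tau>\<^sup>m\<close>
  becomes the power of \<open>\<epsilon>\<close> with exponent \<open>m * v j\<close>. It divides
  \<open>h\<close> rescaled around \<open>p\<^sub>j\<close>.\<close>

lemma corresponds_imp_fat_ideal:
  fixes P :: "complex ^ 'n::finite ^ 3"
  assumes S: "P ** S = mat 1" and k: "\<And>j. P $ k j $ j \<noteq> 0"
    and g: "corresponds P v g (single m h)"
  shows "h \<in> fat_ideal P v m"
  unfolding fat_ideal_iff[of P k, OF k]
proof
  fix j
  show "subst (to_coord (column j P) (k j)) h \<in> order_ge (off (k j)) (nat (m * int (v j)))"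
  proof (cases "m \<ge> 0")
    case True
    obtain \<theta> :: "'n + 'n \<Rightarrow> nat \<Rightarrow>\<^sub>0 3 cpoly" where \<theta>:
      "\<And>i. \<theta> (Inl i) = (if i = j then single 1 1 else 1)"
      "\<And>l. subst \<theta> (zform P l) =
        subst (\<lambda>i. single (off (k j) i) (Var i)) (to_coord (column j P) (k j) l)"
      using subst_zform_near_point[OF S k[of j]] by blast
    have K: "nat (m * int (v j)) = nat m * v j"
      using True by (simp add: nat_mult_distrib)
    have "(\<Prod>i\<in>UNIV. \<theta> (Inl i) ^ (nat m * v i)) = (\<Prod>i\<in>UNIV. if i = j then single 1 1 ^ (nat m * v j) else 1)"
      by (intro prod.cong) (auto simp: \<theta>)
    also have "\<dots> = single 1 1 ^ (nat m * v j)"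
      by simp
    also have "\<dots> = single (nat m * v j) 1"
      by (simp add: power_single_nat)
    finally have eps: "(\<Prod>i\<in>UNIV. \<theta> (Inl i) ^ (nat m * v i)) = single (nat m * v j) 1" .
    have "subst (\<lambda>i. single (off (k j) i) (Var i)) (subst (to_coord (column j P) (k j)) h) =
        subst \<theta> (subst (zform P) h)"
      by (simp add: subst_subst \<theta>)
    also have "\<dots> = subst \<theta> g * single (nat m * v j) 1"
      unfolding corresponds_single_nonneg[OF g True] by (simp add: subst_mult subst_prod subst_power eps)
    finally show ?thesis
      unfolding K by (rule order_ge_if_weight_divides)
  next
    case False
    \<comment> \<open>The exponent is truncated to 0, so there is no condition.\<close>
    then have "m * int (v j) \<le> 0"
      by (simp add: mult_nonpos_nonneg)
    then show ?thesis by simp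
  qed
qed

section \<open>From vanishing at the points to divisibility\<close>

lemma divides_monomial:
  fixes f :: "'v cpoly"
  assumes "\<And>\<mu> i. \<mu> \<in> keys f \<Longrightarrow> lookup \<kappa> i \<le> lookup \<mu> i"
  obtains g where "f = g * single \<kappa> 1"
proof
  have "single (\<mu> - \<kappa>) (lookup f \<mu>) * single \<kappa> 1 = single \<mu> (lookup f \<mu>)" if "\<mu> \<in> keys f" for \<mu>
  proof -
    \<comment> \<open>Subtraction of exponents is truncated, but \<open>\<kappa>\<close> is below
      \<open>\<mu>\<close>.\<close>
    have "\<mu> - \<kappa> + \<kappa> = \<mu>"
      by (rule poly_mapping_eqI) (simp add: lookup_add lookup_minus assms[OF that])
    then show ?thesis by (simp add: mult_single)
  qed
  then show "f = (\<Sum>\<mu>\<in>keys f. single (\<mu> - \<kappa>) (lookup f \<mu>)) * single \<kappa> 1"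
    by (simp add: sum_distrib_right sum_single_keys)
qed

text \<open>Modulo \<open>x\<^sub>j\<close> only the \<open>y\<^sub>j\<close> terms of
  \<open>z\<close> remain and \<open>z\<close> is a multiple of \<open>p\<^sub>j\<close>. Linear
  forms vanishing at \<open>p\<^sub>j\<close> thus become divisible by
  \<open>x\<^sub>j\<close>.\<close>

lemma zform_order:
  fixes P :: "complex ^ 'n::finite ^ 3"
  assumes k: "P $ k $ j \<noteq> 0" and h: "subst (to_coord (column j P) k) h \<in> order_ge (off k) K"
  shows "subst (zform P) h \<in> order_ge (\<lambda>l. if l = Inl j then 1 else 0) K"
proof -
  let ?w = "\<lambda>l :: 'n + 'n. if l = Inl j then 1 else 0 :: nat"
  let ?T = "\<lambda>i. Var (Inr i) * (\<Prod>l\<in>-{i}. Var (Inl l)) :: ('n + 'n) cpoly"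
  have T: "?T i \<in> order_ge ?w 1" if "i \<noteq> j" for i
  proof -
    have "(\<Prod>l\<in>-{i}. Var (Inl l)) = Var (Inl j) * (\<Prod>l\<in>-{i}-{j}. Var (Inl l) :: ('n + 'n) cpoly)"
      using that by (intro prod.remove) auto
    then have "?T i = (Var (Inr i) * (\<Prod>l\<in>-{i}-{j}. Var (Inl l))) * Var (Inl j)"
      by (simp add: mult_ac)
    moreover have "Var (Inl j) \<in> order_ge ?w 1"
      by (simp add: order_ge_def Var_def)
    ultimately show ?thesis
      by (simp only: order_ge_mult_left)
  qed
  have coord: "subst (zform P) (from_coord (column j P) k i) \<in> order_ge ?w (off k i)" for i
  proof (cases "i = k")
    case False
    \<comment> \<open>This makes the coefficient at \<open>l = j\<close> vanish; every other
      \<open>?T l\<close> contains \<open>x\<^sub>j\<close>.\<close>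
    define r where "r = P $ i $ j / P $ k $ j"
    have "subst (zform P) (from_coord (column j P) k i) =
        (\<Sum>l\<in>UNIV. scalar (P $ i $ l - r * P $ k $ l) * ?T l)"
      using False by (simp add: from_coord_def subst_minus subst_mult column_def zform_def scalar_diff
          scalar_mult sum_distrib_left sum_subtractf left_diff_distrib mult.assoc flip: r_def)
    also have "\<dots> \<in> order_ge ?w 1"
    proof (rule order_ge_sum)
      fix l
      show "scalar (P $ i $ l - r * P $ k $ l) * ?T l \<in> order_ge ?w 1"
        using k T by (cases "l = j") (auto simp: r_def scalar_0 intro: order_ge_mult_left)
    qed
    finally show ?thesis using False by (simp add: off_def)
  qed (simp add: off_def)
  have "subst (\<lambda>i. subst (zform P) (from_coord (column j P) k i)) (subst (to_coord (column j P) k) h)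
      \<in> order_ge ?w K"
    by (rule order_ge_subst[OF h coord])
  then show ?thesis
    using k by (simp add: subst_from_to_coord column_def flip: subst_subst)
qed

text \<open>For \<open>m \<ge> 0\<close>, each \<open>x\<^sub>j\<close> divides \<open>h(z)\<close>
  to the power \<open>m * v j\<close>, hence so does the monomial \<open>\<tau>\<^sup>m\<close>, and
  the quotient is the witness.\<close>

lemma fat_ideal_imp_corresponds:
  fixes P :: "complex ^ 'n::finite ^ 3"
  assumes k: "\<And>j. P $ k j $ j \<noteq> 0" and h: "h \<in> fat_ideal P v m"
  shows "\<exists>g. corresponds P v g (single m h)"
proof (cases "m \<ge> 0")
  case True
  define \<kappa> :: "('n + 'n) \<Rightarrow>\<^sub>0 nat" where "\<kappa> = (\<Sum>i\<in>UNIV. single (Inl i) (nat m * v i))"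
  have \<kappa>_Inl: "lookup \<kappa> (Inl j) = nat m * v j" and \<kappa>_Inr: "lookup \<kappa> (Inr j) = 0" for j
    by (simp_all add: \<kappa>_def lookup_sum lookup_single when_def)
  obtain g where g: "subst (zform P) h = g * single \<kappa> 1"
  proof (rule divides_monomial)
    fix \<mu> i assume \<mu>: "\<mu> \<in> keys (subst (zform P) h)"
    show "lookup \<kappa> i \<le> lookup \<mu> i"
    proof (cases i)
      case (Inl j)
      have "subst (zform P) h \<in> order_ge (\<lambda>l. if l = Inl j then 1 else 0) (nat (m * int (v j)))"
        using h k by (intro zform_order[of P "k j"]) (auto simp: fat_ideal_iff[of P k, OF k])
      with \<mu> have "nat (m * int (v j)) \<le> lookup \<mu> (Inl j)"
        unfolding order_ge_def wdeg_indicator by blast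
      then show ?thesis
        using True Inl by (simp add: \<kappa>_Inl nat_mult_distrib)
    qed (simp add: \<kappa>_Inr)
  qed
  have "corresponds P v g (single m h)"
    unfolding corresponds_single
  proof (intro allI impI)
    fix x y :: "'n \<Rightarrow> complex" assume "\<forall>i. x i \<noteq> 0"
    then have x: "\<And>i. x i \<noteq> 0" by blast
    let ?\<tau> = "\<Prod>i\<in>UNIV. x i ^ v i"
    have "single \<kappa> 1 = (\<Prod>i\<in>UNIV. Var (Inl i) ^ (nat m * v i) :: ('n + 'n) cpoly)"
      by (simp add: \<kappa>_def Var_power prod_single_1)
    then have "subst (case_sum x y) (single \<kappa> 1) = (\<Prod>i\<in>UNIV. x i ^ (nat m * v i))"
      by (simp add: subst_prod subst_power)
    also have "\<dots> = ?\<tau> ^ nat m"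
      by (simp add: prod_power_distrib mult.commute flip: power_mult)
    also have "\<dots> = ?\<tau> powi m"
      using True by (simp add: power_int_def)
    finally have "subst (zval P x y) h = subst (case_sum x y) g * ?\<tau> powi m"
      using arg_cong[OF g, of "subst (case_sum x y)"] by (simp add: subst_subst subst_mult flip: zval_def)
    then show "subst (case_sum x y) g = subst (zval P x y) h * ?\<tau> powi (- m)"
      using prod_power_nonzero[of x v, OF x] by (simp add: power_int_minus)
  qed
  then show ?thesis ..
next
  case False
  \<comment> \<open>For negative \<open>m\<close>, dividing by \<open>\<tau>\<^sup>m\<close> is
    multiplying by a monomial.\<close>
  have "corresponds P v (subst (zform P) h * (\<Prod>i\<in>UNIV. Var (Inl i) ^ v i) ^ nat (- m)) (single m h)"
    using False unfolding corresponds_single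
    by (simp add: subst_subst subst_mult subst_prod subst_power power_int_def flip: zval_def)
  then show ?thesis ..
qed

lemma lookup_mult_mem_graded:
  fixes F G :: "'a::monoid_add \<Rightarrow>\<^sub>0 'b::semiring_0"
  assumes "\<And>a. lookup F a \<in> A a" "\<And>a. lookup G a \<in> A a"
    and zero: "\<And>a. 0 \<in> A a" and add: "\<And>a r s. r \<in> A a \<Longrightarrow> s \<in> A a \<Longrightarrow> r + s \<in> A a"
    and mult: "\<And>a b r s. r \<in> A a \<Longrightarrow> s \<in> A b \<Longrightarrow> r * s \<in> A (a + b)"
  shows "lookup (F * G) c \<in> A c"
proof -
  have sum: "(\<Sum>i\<in>I. f i) \<in> A c" if "\<And>i. i \<in> I \<Longrightarrow> f i \<in> A c" for I and f :: "'a \<Rightarrow> 'b"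
    using that by (induction I rule: infinite_finite_induct) (auto intro: zero add)
  show ?thesis
    unfolding poly_mapping_mult_expand lookup_sum
    by (intro sum) (use assms in \<open>auto simp: lookup_single when_def\<close>)
qed

section \<open>The bigrading\<close>

lemma sum_degrees_eq_induced: "sum_degrees = induced (single 0) (\<lambda>(m, d). single m 1)"
  by (simp add: fun_eq_iff sum_degrees_def induced_def mult_single case_prod_unfold)

interpretation sum_degrees: induced_hom "single 0" "\<lambda>(m, d). single m 1"
  by standard (auto simp: single_add mult_single)

lemma sum_degrees_add: "sum_degrees (F + G) = sum_degrees F + sum_degrees G"
  unfolding sum_degrees_eq_induced by (rule sum_degrees.add)

lemma sum_degrees_mult: "sum_degrees (F * G) = sum_degrees F * sum_degrees G"
  unfolding sum_degrees_eq_induced by (rule sum_degrees.mult)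

lemma sum_degrees_sum: "sum_degrees (\<Sum>i\<in>A. F i) = (\<Sum>i\<in>A. sum_degrees (F i))"
  unfolding sum_degrees_eq_induced by (rule sum_degrees.sum)

lemma sum_degrees_single: "sum_degrees (single (m, d) r) = single m r"
  by (simp add: sum_degrees_eq_induced sum_degrees.single mult_single)

lemma sum_degrees_scalar: "sum_degrees (scalar a) = scalar a"
  by (simp add: scalar_poly_mapping_def[where 'a = int] scalar_poly_mapping_def[where 'a = "int \<times> nat"]
      zero_prod_def sum_degrees_single)

text \<open>Parts of different degree cannot cancel, so a bigraded family is recovered from its
  image: \<open>sum_degrees\<close> is injective.\<close>

lemma hom_part_sum_degrees:
  assumes "\<And>m d. homogeneous d (lookup F (m, d))"
  shows "hom_part d (lookup (sum_degrees F) m) = lookup F (m, d)"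
proof -
  have "hom_part d (lookup (sum_degrees F) m) =
      (\<Sum>a\<in>keys F. hom_part d (lookup (single (fst a) (lookup F a)) m))"
    by (simp add: sum_degrees_def lookup_sum hom_part_sum case_prod_unfold)
  also have "\<dots> = (\<Sum>a\<in>keys F. if a = (m, d) then lookup F a else 0)"
  proof (intro sum.cong refl)
    fix a
    show "hom_part d (lookup (single (fst a) (lookup F a)) m) = (if a = (m, d) then lookup F a else 0)"
      using assms[of "snd a" "fst a"]
      by (cases a) (auto simp: lookup_single when_def hom_part_homogeneous hom_part_homogeneous[of 0 0])
  qed
  also have "\<dots> = lookup F (m, d)"
    by (auto simp: in_keys_iff)
  finally show ?thesis .
qed

text \<open>Surjectivity is the homogeneity of the fat point ideals: the coordinate changes are
  linear and \<open>order_ge\<close> is a monomial condition, so members have their homogeneous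
  parts in the ideal.\<close>

lemma bigraded_iso:
  fixes P :: "complex ^ 'n::finite ^ 3"
  assumes k: "\<And>j. P $ k j $ j \<noteq> 0"
  shows "algebra_iso (bigraded_rees_algebra P v) (rees_algebra P v) sum_degrees"
proof -
  note fat = fat_ideal_iff[of P k, OF k]
  have zero: "0 \<in> fat_ideal P v m" for m
    by (simp add: fat)
  have add: "f + g \<in> fat_ideal P v m" if "f \<in> fat_ideal P v m" "g \<in> fat_ideal P v m" for f g m
    using that by (simp add: fat subst_add order_ge_add)
  have sum: "(\<Sum>i\<in>I. f i) \<in> fat_ideal P v m" if "\<And>i. i \<in> I \<Longrightarrow> f i \<in> fat_ideal P v m"
    for f m and I :: "(int \<times> nat) set"
    using that by (induction I rule: infinite_finite_induct) (auto intro: zero add)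
  have mult: "f * g \<in> fat_ideal P v (m + m')" if "f \<in> fat_ideal P v m" "g \<in> fat_ideal P v m'" for f g m m'
    unfolding fat
  proof
    fix j
    \<comment> \<open>Truncation at 0 is subadditive, which covers \<open>m\<close> and
      \<open>m'\<close> of different signs.\<close>
    have "nat ((m + m') * int (v j)) \<le> nat (m * int (v j)) + nat (m' * int (v j))"
      unfolding distrib_right by linarith
    then show "subst (to_coord (column j P) (k j)) (f * g) \<in>
        order_ge (off (k j)) (nat ((m + m') * int (v j)))"
      using that unfolding subst_mult fat by (blast intro: order_ge_mono order_ge_mult)
  qed
  have part: "hom_part d f \<in> fat_ideal P v m" if "f \<in> fat_ideal P v m" for d f m
    using that by (simp add: fat order_ge_hom_part hom_part_subst[OF homogeneous_to_coord, symmetric])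
  have scalar: "scalar a \<in> fat_ideal P v 0" for a
    by (simp add: fat)

  have "subalgebra (rees_algebra P v)"
    unfolding subalgebra_def rees_algebra_def
    using scalar by (auto simp: scalar_poly_mapping_def[where 'a = int] lookup_single when_def
        lookup_add zero intro: add lookup_mult_mem_graded[where A = "fat_ideal P v"] mult)
  moreover have "subalgebra (bigraded_rees_algebra P v)"
  proof -
    let ?A = "\<lambda>a. hom_component (fat_ideal P v (fst a)) (snd a)"
    have mem: "F \<in> bigraded_rees_algebra P v \<longleftrightarrow> (\<forall>a. lookup F a \<in> ?A a)" for F
      by (auto simp: bigraded_rees_algebra_def)
    have mult': "lookup (F * G) a \<in> ?A a"
      if "\<And>a. lookup F a \<in> ?A a" "\<And>a. lookup G a \<in> ?A a" for F G a
    proof (rule lookup_mult_mem_graded[where A = ?A, OF that])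
      show "0 \<in> ?A a" for a
        by (simp add: hom_component_def zero)
      show "r + s \<in> ?A a" if "r \<in> ?A a" "s \<in> ?A a" for r s a
        using that by (simp add: hom_component_def add homogeneous_add)
      show "r * s \<in> ?A (a + b)" if "r \<in> ?A a" "s \<in> ?A b" for r s a b
        using that by (simp add: hom_component_def mult homogeneous_mult)
    qed
    have add': "lookup (F + G) a \<in> ?A a"
      if "\<And>a. lookup F a \<in> ?A a" "\<And>a. lookup G a \<in> ?A a" for F G a
      using that(1)[of a] that(2)[of a] by (simp add: hom_component_def lookup_add add homogeneous_add)
    have scalar': "lookup (scalar r) a \<in> ?A a" for r a
      using scalar by (auto simp: scalar_poly_mapping_def[where 'a = "int \<times> nat"] lookup_single when_def
          hom_component_def zero)
    show ?thesis
      unfolding subalgebra_def mem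
    proof (intro conjI ballI allI subsetI)
      show "F \<in> bigraded_rees_algebra P v" if "F \<in> range scalar" for F
        unfolding mem using that scalar' by auto
      fix F G a assume "F \<in> bigraded_rees_algebra P v" "G \<in> bigraded_rees_algebra P v"
      then have "\<And>a. lookup F a \<in> ?A a" "\<And>a. lookup G a \<in> ?A a"
        unfolding mem by blast+
      then show "lookup (F + G) a \<in> ?A a" "lookup (F * G) a \<in> ?A a"
        by (rule add', rule mult')
    qed
  qed
  moreover have "bij_betw sum_degrees (bigraded_rees_algebra P v) (rees_algebra P v)"
    unfolding bij_betw_def
  proof (intro conjI equalityI subsetI inj_onI)
    fix F G
    assume "F \<in> bigraded_rees_algebra P v" "G \<in> bigraded_rees_algebra P v"
      and eq: "sum_degrees F = sum_degrees G"
    then have "homogeneous d (lookup F (m, d))" "homogeneous d (lookup G (m, d))" for m d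
      by (auto simp: bigraded_rees_algebra_def hom_component_def)
    then have "lookup F (m, d) = lookup G (m, d)" for m d
      using eq by (metis hom_part_sum_degrees)
    then show "F = G"
      by (intro poly_mapping_eqI) auto
  next
    fix H assume "H \<in> sum_degrees ` bigraded_rees_algebra P v"
    then obtain F where F: "F \<in> bigraded_rees_algebra P v" and H: "H = sum_degrees F" by blast
    have "lookup H m \<in> fat_ideal P v m" for m
      unfolding H sum_degrees_def lookup_sum
      using F by (intro sum) (auto simp: bigraded_rees_algebra_def hom_component_def lookup_single when_def zero)
    then show "H \<in> rees_algebra P v"
      by (simp add: rees_algebra_def)
  next
    fix H assume H: "H \<in> rees_algebra P v"
    \<comment> \<open>One finite set of degrees serves all components of \<open>H\<close>.\<close>
    define D where "D = (\<Union>m\<in>keys H. wdeg (\<lambda>_. 1) ` keys (lookup H m))"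
    define F where "F = (\<Sum>m\<in>keys H. \<Sum>d\<in>D. single (m, d) (hom_part d (lookup H m)))"
    have D: "finite D" by (simp add: D_def)
    have "sum_degrees F = (\<Sum>m\<in>keys H. \<Sum>d\<in>D. single m (hom_part d (lookup H m)))"
      by (simp add: F_def sum_degrees_sum sum_degrees_single)
    also have "\<dots> = (\<Sum>m\<in>keys H. single m (\<Sum>d\<in>D. hom_part d (lookup H m)))"
    proof -
      have "single m (\<Sum>i\<in>A. g i) = (\<Sum>i\<in>A. single m (g i))" for A :: "nat set" and g :: "nat \<Rightarrow> 3 cpoly" and m :: int
        by (induction A rule: infinite_finite_induct) (simp_all add: single_add)
      then show ?thesis by simp
    qed
    also have "\<dots> = (\<Sum>m\<in>keys H. single m (lookup H m))"
      using D by (intro sum.cong refl arg_cong[where f = "single _"] sum_hom_part) (auto simp: D_def)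
    finally have "sum_degrees F = H"
      by (simp add: sum_single_keys)
    moreover have "lookup F (m, d) \<in> hom_component (fat_ideal P v m) d" for m d
    proof -
      have "lookup F (m, d) = (\<Sum>m'\<in>keys H. \<Sum>d'\<in>D. if m' = m \<and> d' = d then hom_part d (lookup H m) else 0)"
        by (auto simp: F_def lookup_sum lookup_single when_def intro!: sum.cong)
      also have "\<dots> = (if m \<in> keys H \<and> d \<in> D then hom_part d (lookup H m) else 0)"
      proof -
        have "(\<Sum>d'\<in>D. if m' = m \<and> d' = d then r else 0) = (if m' = m then if d \<in> D then r else 0 else 0)"
          for m' and r :: "3 cpoly"
          using D by (cases "m' = m") simp_all
        then show ?thesis by simp
      qed
      finally show ?thesis
        using H part by (auto simp: hom_component_def rees_algebra_def zero)
    qed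
    ultimately show "H \<in> sum_degrees ` bigraded_rees_algebra P v"
      by (intro image_eqI[of _ _ F]) (auto simp: bigraded_rees_algebra_def)
  qed
  ultimately show ?thesis
    unfolding algebra_iso_def
    by (simp add: sum_degrees_add sum_degrees_mult sum_degrees_scalar)
qed

section \<open>The isomorphism with the invariant ring\<close>

text \<open>A nonzero vector killed by the transpose of \<open>P\<close> would be the equation of a
  line through all the points. So the transpose is injective and has a left inverse.\<close>

lemma ex_right_inverse:
  fixes P :: "complex ^ 'n::finite ^ 3"
  assumes "\<forall>j. column j P \<noteq> 0"
    and "\<not> (\<exists>a. a \<noteq> 0 \<and> (\<forall>j. proj_point (column j P) \<in> proj_line a))"
  shows "\<exists>S. P ** S = mat 1"
proof -
  have "a = 0" if "transpose P *v a = 0" for a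
  proof (rule ccontr)
    assume "a \<noteq> 0"
    have "(\<Sum>k\<in>UNIV. a $ k * column j P $ k) = 0" for j
    proof -
      have "(transpose P *v a) $ j = 0" using that by simp
      then show ?thesis
        by (simp add: matrix_vector_mult_def transpose_def column_def mult.commute)
    qed
    then have "proj_point (column j P) \<in> proj_line a" for j
      using assms(1) by (auto simp: proj_line_def)
    with \<open>a \<noteq> 0\<close> assms(2) show False by blast
  qed
  then obtain B where "B ** transpose P = mat 1"
    using matrix_left_invertible_ker[of "transpose P"] by blast
  then have "P ** transpose B = mat 1"
    by (metis matrix_transpose_mul transpose_mat transpose_transpose)
  then show ?thesis ..
qed

text \<open>\<open>corresponds\<close> pairs each invariant with exactly one Rees element and
  conversely. It respects sums, products and scalars, so the function with this graph is an
  isomorphism.\<close>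

lemma invariants_iso:
  fixes P :: "complex ^ 'n::finite ^ 3"
  assumes S: "P ** S = mat 1" and k: "\<And>j. P $ k j $ j \<noteq> 0" and v: "\<And>i. v i > 0"
  shows "\<exists>\<phi>. algebra_iso (invariants (sigma_group P v)) (rees_algebra P v) \<phi>"
proof -
  let ?R = "corresponds P v"
  note right_unique = corresponds_right_unique[of P S v, OF S v]
  have total: "\<exists>F\<in>rees_algebra P v. ?R f F" if f: "f \<in> invariants (sigma_group P v)" for f
  proof -
    obtain T g h where T: "finite T" "f = (\<Sum>m\<in>T. g m)"
      and gh: "\<And>m. m \<in> T \<Longrightarrow> ?R (g m) (single m (h m))"
      using invariant_components[of P S v f, OF S v f] by blast
    have "?R f (\<Sum>m\<in>T. single m (h m))"
      unfolding T using gh by (rule corresponds_sum)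
    moreover have "lookup (\<Sum>m\<in>T. single m (h m)) m \<in> fat_ideal P v m" for m
    proof -
      have "lookup (\<Sum>m\<in>T. single m (h m)) m = (if m \<in> T then h m else 0)"
        using T(1) by (simp add: lookup_sum lookup_single when_def)
      moreover have "0 \<in> fat_ideal P v m"
        by (simp add: fat_ideal_iff[of P k, OF k])
      ultimately show ?thesis
        using corresponds_imp_fat_ideal[of P S k v "g m" m "h m", OF S k] gh by simp
    qed
    ultimately show ?thesis
      by (auto simp: rees_algebra_def)
  qed
  have surj: "\<exists>f. ?R f F" if F: "F \<in> rees_algebra P v" for F
  proof -
    have "\<forall>m. \<exists>g. ?R g (single m (lookup F m))"
      using fat_ideal_imp_corresponds[of P k _ v, OF k] F by (simp add: rees_algebra_def)
    then obtain g where "\<And>m. ?R (g m) (single m (lookup F m))" by metis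
    then have "?R (\<Sum>m\<in>keys F. g m) (\<Sum>m\<in>keys F. single m (lookup F m))"
      by (intro corresponds_sum)
    then show ?thesis
      by (auto simp: sum_single_keys)
  qed
  have inv: "f \<in> invariants (sigma_group P v) \<longleftrightarrow> (\<exists>F. ?R f F)" for f
    using total corresponds_imp_invariant by blast
  \<comment> \<open>By uniqueness, any partner \<open>F\<close> of \<open>f\<close> is the one that
    \<open>total\<close> finds in the Rees algebra.\<close>
  have rees: "F \<in> rees_algebra P v \<longleftrightarrow> (\<exists>f. ?R f F)" for F
  proof
    assume "\<exists>f. ?R f F"
    then obtain f where f: "?R f F" ..
    then obtain F' where "F' \<in> rees_algebra P v" "?R f F'"
      using total inv by blast
    with f show "F \<in> rees_algebra P v"
      using right_unique by metis
  qed (rule surj)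
  define \<phi> where "\<phi> f = (THE F. ?R f F)" for f
  have \<phi>_eq: "\<phi> f = F" if "?R f F" for f F
    unfolding \<phi>_def using that right_unique by (intro the_equality) auto
  have "bij_betw \<phi> (invariants (sigma_group P v)) (rees_algebra P v)"
    unfolding bij_betw_def
  proof (intro conjI inj_onI set_eqI)
    fix f g assume "f \<in> invariants (sigma_group P v)" "g \<in> invariants (sigma_group P v)" "\<phi> f = \<phi> g"
    then show "f = g"
      unfolding inv by (metis \<phi>_eq corresponds_left_unique)
  next
    fix F
    show "F \<in> \<phi> ` invariants (sigma_group P v) \<longleftrightarrow> F \<in> rees_algebra P v"
      unfolding image_iff Bex_def inv rees by (metis \<phi>_eq)
  qed
  moreover have "subalgebra (invariants (sigma_group P v))"
    unfolding subalgebra_def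
  proof (intro conjI ballI subsetI)
    fix f g assume "f \<in> invariants (sigma_group P v)" "g \<in> invariants (sigma_group P v)"
    then obtain F G where "?R f F" "?R g G"
      unfolding inv by blast
    then show "f + g \<in> invariants (sigma_group P v)" "f * g \<in> invariants (sigma_group P v)"
      using corresponds_add corresponds_mult unfolding inv by blast+
  qed (auto simp: inv intro: corresponds_scalar)
  moreover have "subalgebra (rees_algebra P v)"
    unfolding subalgebra_def
  proof (intro conjI ballI subsetI)
    fix F G assume "F \<in> rees_algebra P v" "G \<in> rees_algebra P v"
    then obtain f g where "?R f F" "?R g G"
      unfolding rees by blast
    then show "F + G \<in> rees_algebra P v" "F * G \<in> rees_algebra P v"
      using corresponds_add corresponds_mult unfolding rees by blast+
  qed (auto simp: rees intro: corresponds_scalar)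
  moreover have "\<phi> (f + g) = \<phi> f + \<phi> g \<and> \<phi> (f * g) = \<phi> f * \<phi> g"
    if "f \<in> invariants (sigma_group P v)" "g \<in> invariants (sigma_group P v)" for f g
    using that unfolding inv by (metis \<phi>_eq corresponds_add corresponds_mult)
  moreover have "\<phi> (scalar a) = scalar a" for a
    by (rule \<phi>_eq) (rule corresponds_scalar)
  ultimately show ?thesis
    unfolding algebra_iso_def by blast
qed

theorem proposition1p4:
  fixes P :: "complex ^ 'n::finite ^ 3" and v :: "'n \<Rightarrow> nat"
  assumes "\<forall>j. column j P \<noteq> 0"
    and "inj (\<lambda>j. proj_point (column j P))"
    and "\<not> (\<exists>a. a \<noteq> 0 \<and> (\<forall>j. proj_point (column j P) \<in> proj_line a))"
    and "\<forall>j. v j > 0"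
  shows "(\<exists>\<phi>. algebra_iso (invariants (sigma_group P v)) (rees_algebra P v) \<phi>) \<and>
    algebra_iso (bigraded_rees_algebra P v) (rees_algebra P v) sum_degrees"
proof -
  obtain S where S: "P ** S = mat 1"
    using ex_right_inverse assms by blast
  \<comment> \<open>A nonzero entry of each column is the pivot of the coordinate change at that
    point.\<close>
  have "\<exists>k. P $ k $ j \<noteq> 0" for j
    using assms(1) by (auto simp: vec_eq_iff column_def)
  then obtain k where k: "\<And>j. P $ k j $ j \<noteq> 0"
    by metis
  show ?thesis
    using invariants_iso[of P S k v, OF S k] bigraded_iso[of P k v, OF k] assms(4) by blast
qed

end
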